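(* Let $G$ be an abelian group and consider the $G$-graded algebra $R=\mathrm{End}_D(V)$ where $D$ is a $G$-graded-division algebra over a field $\mathbb F$ and $V$ is a nonzero $G$-graded right $D$-module of finite rank. (1) If $\varphi$ is an antiautomorphism of the graded algebra $R$, then there exist an antiautomorphism $\varphi_0$ of the graded algebra $D$ and a nondegenerate $\mathbb F$-bilinear mapping $B:V\times V\to D$ that is $\varphi_0$-sesquilinear over $D$, i.e., (i) $B(vd,w)=\varphi_0(d)B(v,w)$ and $B(v,wd)=B(v,w)d$ for all $d\in D$ and $v,w\in V$, homogeneous of some degree $g_0\in G$, i.e., (ii) $B(V_a,V_b)\subset D_{g_0ab}$ for all $a,b\in G$, and such that $\varphi$ is the adjunction with respect to $B$, i.e., (iii) $B(rv,w)=B(v,\varphi(r)w)$ for all $r\in R$ and $v,w\in V$. (2) Another pair $(\varphi_0',B')$ satisfies these conditions if and only if there exists $d\in D^\times_{\mathrm{gr}}$ such that $B'=dB$ and $\varphi_0'=\mathrm{Int}(d)\circ\varphi_0$. (3) If $\varphi$ is an involution, then the pair $(\varphi_0,B)$ as in part (1) can be chosen so that $\varphi_0$ is an involution and $B$ is hermitian or skew-hermitian, i.e., $B(w,v)=\delta\varphi_0(B(v,w))$ for all $v,w\in V$, where $\delta=1$ (hermitian) or $\delta=-1$ (skew-hermitian). (4) Let $(\varphi_0,B)$ be a pair chosen for an involution $\varphi$ as in part (3), with the corresponding $\delta\in\{\pm1\}$. Then: (i) Any other such pair $(\varphi_0',B')$ has the form $(\mathrm{Int}(d)\circ\varphi_0,\,dB)$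 where $d\in D^\times_{\mathrm{gr}}$ satisfies $\varphi_0(d)=d$ (symmetric) or $\varphi_0(d)=-d$ (skew-symmetric). More precisely, $B'(w,v)=\delta'\varphi_0'(B'(v,w))$ for all $v,w\in V$, where $\delta'=\delta$ if $d$ is symmetric and $\delta'=-\delta$ if $d$ is skew-symmetric. (ii) If $\varphi_0'$ is a degree-preserving involution of $D$ such that $\varphi_0'\varphi_0^{-1}$ is an inner automorphism of $D$, then there exists $d\in D^\times_{\mathrm{gr}}$ such that $\varphi_0'=\mathrm{Int}(d)\circ\varphi_0$ and the pair $(\varphi_0',dB)$ satisfies the conditions of part (3).
   Context: All algebras are associative over an arbitrary field $\mathbb F$. A $G$-grading on an algebra $A$ is a decomposition $A=\bigoplus_{g\in G}A_g$ with $A_gA_h\subset A_{gh}$; nonzero elements of $A_g$ are homogeneous of degree $g$. A graded-division algebra is a unital graded algebra in which all nonzero homogeneous elements are invertible. For such $D$, $D^\times_{\mathrm{gr}}$ denotes the group of nonzero homogeneous elements, and $\mathrm{Int}(d)(x)=dxd^{-1}$. A graded right $D$-module $V=\bigoplus_g V_g$ satisfies $V_gD_h\subset V_{gh}$; it is always free, with a basis of homogeneous elements. $R=\mathrm{End}_D(V)$ is graded by $R_g=\{r\in R\mid rV_h\subset V_{gh}\ \forall h\in G\}$. An antiautomorphism of a graded algebra is an $\mathbb F$-linear antiautomorphism that preserves degree, i.e., maps each homogeneous component to itself; an involution of a graded algebra is such an antiautomorphism whose square is the identity. *)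

theory Defs
  imports Complex_Main
begin

text \<open>The grading group is an arbitrary abelian group, written additively (\<open>'g :: ab_group_add\<close>);
  thus the degree \<open>g\<^sub>0ab\<close> becomes \<open>g0 + a + b\<close>.\<close>

locale graded_space = vector_space scale
  for scale :: "'f::field \<Rightarrow> 'a::ab_group_add \<Rightarrow> 'a" +
  fixes Gr :: "'g \<Rightarrow> 'a set"
  assumes subspace_Gr: "subspace (Gr g)"
    and direct_sum: "\<exists>!c. finite {g. c g \<noteq> 0} \<and> (\<forall>g. c g \<in> Gr g) \<and> x = (\<Sum>g | c g \<noteq> 0. c g)"

locale graded_algebra = graded_space scale Gr
  for scale :: "'f::field \<Rightarrow> 'a::ring_1 \<Rightarrow> 'a" and Gr :: "'g::ab_group_add \<Rightarrow> 'a set" +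
  assumes scale_mult_left: "scale c x * y = scale c (x * y)"
    and scale_mult_right: "x * scale c y = scale c (x * y)"
    and Gr_mult: "x \<in> Gr g \<Longrightarrow> y \<in> Gr h \<Longrightarrow> x * y \<in> Gr (g + h)"

definition invertible_elt :: "'a::ring_1 \<Rightarrow> bool" where
  "invertible_elt x \<longleftrightarrow> (\<exists>y. x * y = 1 \<and> y * x = 1)"

definition ring_inv :: "'a::ring_1 \<Rightarrow> 'a" where
  "ring_inv x = (THE y. x * y = 1 \<and> y * x = 1)"

text \<open>\<open>Int(d)\<close>; only meaningful for invertible \<open>d\<close>.\<close>
definition inner_aut :: "'a::ring_1 \<Rightarrow> 'a \<Rightarrow> 'a" where
  "inner_aut d x = d * x * ring_inv d"

definition is_inner_aut :: "('a::ring_1 \<Rightarrow> 'a) \<Rightarrow> bool" where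
  "is_inner_aut \<psi> \<longleftrightarrow> (\<exists>u. invertible_elt u \<and> \<psi> = inner_aut u)"

definition gr_units :: "('g \<Rightarrow> 'a::zero set) \<Rightarrow> 'a set" where
  "gr_units Gr = {d. d \<noteq> 0 \<and> (\<exists>g. d \<in> Gr g)}"

locale graded_division_algebra = graded_algebra scale Gr
  for scale :: "'f::field \<Rightarrow> 'a::ring_1 \<Rightarrow> 'a" and Gr :: "'g::ab_group_add \<Rightarrow> 'a set" +
  assumes gr_units_invertible: "d \<in> gr_units Gr \<Longrightarrow> invertible_elt d"

locale graded_right_module =
  D: graded_algebra sD Dg + V: graded_space sV Vg
  for sD :: "'f::field \<Rightarrow> 'd::ring_1 \<Rightarrow> 'd" and Dg :: "'g::ab_group_add \<Rightarrow> 'd set"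
    and sV :: "'f \<Rightarrow> 'v::ab_group_add \<Rightarrow> 'v" and Vg :: "'g \<Rightarrow> 'v set" +
  fixes act :: "'v \<Rightarrow> 'd \<Rightarrow> 'v"
  assumes act_add_left: "act (v + w) d = act v d + act w d"
    and act_add_right: "act v (d + e) = act v d + act v e"
    and act_one: "act v 1 = v"
    and act_mult: "act v (d * e) = act (act v d) e"
    and act_scale_left: "act (sV c v) d = sV c (act v d)"
    and act_scale_right: "act v (sD c d) = sV c (act v d)"
    and act_Gr: "v \<in> Vg g \<Longrightarrow> d \<in> Dg h \<Longrightarrow> act v d \<in> Vg (g + h)"

text \<open>The basis is not required to be homogeneous.\<close>
definition finite_rank :: "('v::ab_group_add \<Rightarrow> 'd::ring_1 \<Rightarrow> 'v) \<Rightarrow> bool" where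
  "finite_rank act \<longleftrightarrow> (\<exists>S. finite S \<and>
     (\<forall>v. \<exists>!c. (\<forall>x. x \<notin> S \<longrightarrow> c x = 0) \<and> v = (\<Sum>x\<in>S. act x (c x))))"

definition End_alg :: "('v::ab_group_add \<Rightarrow> 'd::ring_1 \<Rightarrow> 'v) \<Rightarrow> ('v \<Rightarrow> 'v) set" where
  "End_alg act = {r. (\<forall>v w. r (v + w) = r v + r w) \<and> (\<forall>v d. r (act v d) = act (r v) d)}"

definition End_gr ::
  "('v::ab_group_add \<Rightarrow> 'd::ring_1 \<Rightarrow> 'v) \<Rightarrow> ('g::ab_group_add \<Rightarrow> 'v set) \<Rightarrow> 'g \<Rightarrow> ('v \<Rightarrow> 'v) set" where
  "End_gr act Vg g = {r \<in> End_alg act. \<forall>h. r ` Vg h \<subseteq> Vg (g + h)}"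

text \<open>Antiautomorphisms of a graded algebra given by a carrier, its addition, multiplication and
  scalar multiplication, and its homogeneous components. Explicit operations are used because the
  same notion is needed for \<open>D\<close> (a type) and for \<open>End\<^sub>D(V)\<close> (a set of functions under composition).
  Nothing is said about the values outside the carrier.\<close>
definition graded_antiaut ::
  "'a set \<Rightarrow> ('a \<Rightarrow> 'a \<Rightarrow> 'a) \<Rightarrow> ('a \<Rightarrow> 'a \<Rightarrow> 'a) \<Rightarrow> ('f \<Rightarrow> 'a \<Rightarrow> 'a) \<Rightarrow> ('g \<Rightarrow> 'a set) \<Rightarrow>
   ('a \<Rightarrow> 'a) \<Rightarrow> bool" where
  "graded_antiaut A add mul scale Gr \<phi> \<longleftrightarrow>
     bij_betw \<phi> A A \<and>
     (\<forall>x\<in>A. \<forall>y\<in>A. \<phi> (add x y) = add (\<phi> x) (\<phi> y)) \<and>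
     (\<forall>c. \<forall>x\<in>A. \<phi> (scale c x) = scale c (\<phi> x)) \<and>
     (\<forall>x\<in>A. \<forall>y\<in>A. \<phi> (mul x y) = mul (\<phi> y) (\<phi> x)) \<and>
     (\<forall>g. \<phi> ` Gr g = Gr g)"

definition D_antiaut ::
  "('f::field \<Rightarrow> 'd::ring_1 \<Rightarrow> 'd) \<Rightarrow> ('g::ab_group_add \<Rightarrow> 'd set) \<Rightarrow> ('d \<Rightarrow> 'd) \<Rightarrow> bool" where
  "D_antiaut sD Dg \<phi>0 \<longleftrightarrow> graded_antiaut UNIV (+) (*) sD Dg \<phi>0"

definition D_involution ::
  "('f::field \<Rightarrow> 'd::ring_1 \<Rightarrow> 'd) \<Rightarrow> ('g::ab_group_add \<Rightarrow> 'd set) \<Rightarrow> ('d \<Rightarrow> 'd) \<Rightarrow> bool" where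
  "D_involution sD Dg \<phi>0 \<longleftrightarrow> D_antiaut sD Dg \<phi>0 \<and> (\<forall>x. \<phi>0 (\<phi>0 x) = x)"

definition End_antiaut ::
  "('f::field \<Rightarrow> 'v::ab_group_add \<Rightarrow> 'v) \<Rightarrow> ('g::ab_group_add \<Rightarrow> 'v set) \<Rightarrow>
   ('v \<Rightarrow> 'd::ring_1 \<Rightarrow> 'v) \<Rightarrow> (('v \<Rightarrow> 'v) \<Rightarrow> ('v \<Rightarrow> 'v)) \<Rightarrow> bool" where
  "End_antiaut sV Vg act \<phi> \<longleftrightarrow>
     graded_antiaut (End_alg act) (\<lambda>r s v. r v + s v) (\<circ>) (\<lambda>c r v. sV c (r v)) (End_gr act Vg) \<phi>"

definition End_involution ::
  "('f::field \<Rightarrow> 'v::ab_group_add \<Rightarrow> 'v) \<Rightarrow> ('g::ab_group_add \<Rightarrow> 'v set) \<Rightarrow>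
   ('v \<Rightarrow> 'd::ring_1 \<Rightarrow> 'v) \<Rightarrow> (('v \<Rightarrow> 'v) \<Rightarrow> ('v \<Rightarrow> 'v)) \<Rightarrow> bool" where
  "End_involution sV Vg act \<phi> \<longleftrightarrow>
     End_antiaut sV Vg act \<phi> \<and> (\<forall>r\<in>End_alg act. \<phi> (\<phi> r) = r)"

definition bilinear_map ::
  "('f::field \<Rightarrow> 'v::ab_group_add \<Rightarrow> 'v) \<Rightarrow> ('f \<Rightarrow> 'd::ab_group_add \<Rightarrow> 'd) \<Rightarrow> ('v \<Rightarrow> 'v \<Rightarrow> 'd) \<Rightarrow> bool" where
  "bilinear_map sV sD B \<longleftrightarrow>
     (\<forall>w. Vector_Spaces.linear sV sD (\<lambda>v. B v w)) \<and> (\<forall>v. Vector_Spaces.linear sV sD (B v))"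

definition nondegenerate :: "('v::zero \<Rightarrow> 'v \<Rightarrow> 'd::zero) \<Rightarrow> bool" where
  "nondegenerate B \<longleftrightarrow>
     (\<forall>v. (\<forall>w. B v w = 0) \<longrightarrow> v = 0) \<and> (\<forall>w. (\<forall>v. B v w = 0) \<longrightarrow> w = 0)"

definition sesquilinear ::
  "('v \<Rightarrow> 'd::ring_1 \<Rightarrow> 'v) \<Rightarrow> ('d \<Rightarrow> 'd) \<Rightarrow> ('v \<Rightarrow> 'v \<Rightarrow> 'd) \<Rightarrow> bool" where
  "sesquilinear act \<phi>0 B \<longleftrightarrow>
     (\<forall>d v w. B (act v d) w = \<phi>0 d * B v w) \<and> (\<forall>d v w. B v (act w d) = B v w * d)"

definition homogeneous_form ::
  "('g::ab_group_add \<Rightarrow> 'd set) \<Rightarrow> ('g \<Rightarrow> 'v set) \<Rightarrow> ('v \<Rightarrow> 'v \<Rightarrow> 'd) \<Rightarrow> bool" where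
  "homogeneous_form Dg Vg B \<longleftrightarrow>
     (\<exists>g0. \<forall>a b. \<forall>v\<in>Vg a. \<forall>w\<in>Vg b. B v w \<in> Dg (g0 + a + b))"

definition adjunction ::
  "('v::ab_group_add \<Rightarrow> 'd::ring_1 \<Rightarrow> 'v) \<Rightarrow> (('v \<Rightarrow> 'v) \<Rightarrow> ('v \<Rightarrow> 'v)) \<Rightarrow> ('v \<Rightarrow> 'v \<Rightarrow> 'd) \<Rightarrow> bool" where
  "adjunction act \<phi> B \<longleftrightarrow> (\<forall>r\<in>End_alg act. \<forall>v w. B (r v) w = B v (\<phi> r w))"

definition adjoint_pair ::
  "('f::field \<Rightarrow> 'd::ring_1 \<Rightarrow> 'd) \<Rightarrow> ('g::ab_group_add \<Rightarrow> 'd set) \<Rightarrow>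
   ('f \<Rightarrow> 'v::ab_group_add \<Rightarrow> 'v) \<Rightarrow> ('g \<Rightarrow> 'v set) \<Rightarrow> ('v \<Rightarrow> 'd \<Rightarrow> 'v) \<Rightarrow>
   (('v \<Rightarrow> 'v) \<Rightarrow> ('v \<Rightarrow> 'v)) \<Rightarrow> ('d \<Rightarrow> 'd) \<Rightarrow> ('v \<Rightarrow> 'v \<Rightarrow> 'd) \<Rightarrow> bool" where
  "adjoint_pair sD Dg sV Vg act \<phi> \<phi>0 B \<longleftrightarrow>
     D_antiaut sD Dg \<phi>0 \<and> bilinear_map sV sD B \<and> nondegenerate B \<and>
     sesquilinear act \<phi>0 B \<and> homogeneous_form Dg Vg B \<and> adjunction act \<phi> B"

definition hermitian_sign ::
  "('f \<Rightarrow> 'd \<Rightarrow> 'd) \<Rightarrow> 'f \<Rightarrow> ('d \<Rightarrow> 'd) \<Rightarrow> ('v \<Rightarrow> 'v \<Rightarrow> 'd) \<Rightarrow> bool" where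
  "hermitian_sign sD \<delta> \<phi>0 B \<longleftrightarrow> (\<forall>v w. B w v = sD \<delta> (\<phi>0 (B v w)))"

text \<open>Hermitian for \<open>\<delta> = 1\<close>, skew-hermitian for \<open>\<delta> = -1\<close>; the sign is an element of the base field,
  so that the two cases coincide in characteristic 2.\<close>
definition hermitian_pair ::
  "('f::field \<Rightarrow> 'd::ring_1 \<Rightarrow> 'd) \<Rightarrow> ('g::ab_group_add \<Rightarrow> 'd set) \<Rightarrow>
   ('f \<Rightarrow> 'v::ab_group_add \<Rightarrow> 'v) \<Rightarrow> ('g \<Rightarrow> 'v set) \<Rightarrow> ('v \<Rightarrow> 'd \<Rightarrow> 'v) \<Rightarrow>
   (('v \<Rightarrow> 'v) \<Rightarrow> ('v \<Rightarrow> 'v)) \<Rightarrow> 'f \<Rightarrow> ('d \<Rightarrow> 'd) \<Rightarrow> ('v \<Rightarrow> 'v \<Rightarrow> 'd) \<Rightarrow> bool" where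
  "hermitian_pair sD Dg sV Vg act \<phi> \<delta> \<phi>0 B \<longleftrightarrow>
     adjoint_pair sD Dg sV Vg act \<phi> \<phi>0 B \<and> D_involution sD Dg \<phi>0 \<and>
     \<delta> \<in> {1, -1} \<and> hermitian_sign sD \<delta> \<phi>0 B"

end

theory Submission imports Defs begin

text \<open>Fix a homogeneous \<open>v0 \<noteq> 0\<close> and a homogeneous functional \<open>l\<close> with \<open>l v0 = 1\<close>. If \<open>\<phi>\<close> is an
  antiautomorphism and \<open>s w\<close> is the preimage under \<open>\<phi>\<close> of the rank-one map \<open>x \<mapsto> w (l x)\<close>, then \<open>s v0\<close> is a
  degree-preserving idempotent whose image is a free module \<open>u D\<close> of rank one, because its corner ring
  is anti-isomorphic to the graded-division algebra \<open>D\<close>. The coefficient of \<open>s w v\<close> with respect to \<open>u\<close>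
  is, up to an antiautomorphism of \<open>D\<close>, the required form \<open>B v w\<close>. Conversely \<open>\<phi>\<close> determines a pair
  up to scaling: both forms are recovered from their values at a single vector by means of the
  preimages of rank-one maps. For an involution, \<open>inv \<phi>0 (B w v)\<close> defines another pair, hence equals
  \<open>d * B v w\<close>; either \<open>d = -1\<close> and \<open>B\<close> is skew-hermitian, or \<open>(1 + d) B\<close> is hermitian.\<close>

section \<open>Inverses and inner automorphisms in a ring\<close>

lemma ring_inv:
  fixes x :: "'a::ring_1"
  assumes "invertible_elt x"
  shows "x * ring_inv x = 1" "ring_inv x * x = 1"
proof -
  obtain y where y: "x * y = 1 \<and> y * x = 1"
    using assms unfolding invertible_elt_def by blast
  have "z = y" if "x * z = 1 \<and> z * x = 1" for z
  proof -
    have "z = (y * x) * z" using y by simp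
    also have "\<dots> = y" using that by (simp add: mult.assoc)
    finally show ?thesis .
  qed
  with y have "x * ring_inv x = 1 \<and> ring_inv x * x = 1"
    unfolding ring_inv_def by (rule theI)
  then show "x * ring_inv x = 1" "ring_inv x * x = 1" by auto
qed

lemma inner_aut_mult:
  fixes d :: "'a::ring_1"
  assumes "invertible_elt d"
  shows "inner_aut d x * d = d * x"
  unfolding inner_aut_def using ring_inv[OF assms] by (simp add: mult.assoc)

lemma inner_aut_eqI:
  fixes d :: "'a::ring_1"
  assumes "invertible_elt d" "y * d = d * x"
  shows "y = inner_aut d x"
proof -
  have "y = y * d * ring_inv d" using ring_inv[OF assms(1)] by (simp add: mult.assoc)
  then show ?thesis unfolding inner_aut_def assms(2) .
qed

section \<open>Homogeneous components of vectors\<close>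

context graded_space
begin

definition proj :: "'g \<Rightarrow> 'a \<Rightarrow> 'a" where
  "proj g x = (THE c. finite {g. c g \<noteq> 0} \<and> (\<forall>g. c g \<in> Gr g) \<and> x = (\<Sum>g | c g \<noteq> 0. c g)) g"

lemma proj_unique:
  assumes "finite {g. c g \<noteq> 0}" "\<And>g. c g \<in> Gr g" "x = (\<Sum>g | c g \<noteq> 0. c g)"
  shows "proj g x = c g"
  unfolding proj_def using the1_equality[OF direct_sum, of c x] assms by simp

lemma proj_props: "finite {g. proj g x \<noteq> 0} \<and> (\<forall>g. proj g x \<in> Gr g) \<and> x = (\<Sum>g | proj g x \<noteq> 0. proj g x)"
  unfolding proj_def using theI'[OF direct_sum, of x] by simp

lemma finite_proj: "finite {g. proj g x \<noteq> 0}"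
  and proj_Gr: "proj g x \<in> Gr g"
  and sum_proj: "(\<Sum>g | proj g x \<noteq> 0. proj g x) = x"
  using proj_props[of x] by auto

lemma zero_Gr: "0 \<in> Gr g"
  by (rule subspace_0[OF subspace_Gr])

lemma add_Gr: "x \<in> Gr g \<Longrightarrow> y \<in> Gr g \<Longrightarrow> x + y \<in> Gr g"
  by (rule subspace_add[OF subspace_Gr])

lemma proj_homogeneous:
  assumes "x \<in> Gr h"
  shows "proj g x = (if g = h then x else 0)"
proof (rule proj_unique)
  have "{g. (if g = h then x else 0) \<noteq> 0} = (if x = 0 then {} else {h})" by auto
  then show "finite {g. (if g = h then x else 0) \<noteq> 0}"
    "x = (\<Sum>g | (if g = h then x else 0) \<noteq> 0. if g = h then x else 0)" by auto
qed (use assms zero_Gr in auto)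

lemma proj_add: "proj g (x + y) = proj g x + proj g y"
proof (rule proj_unique)
  let ?S = "{g. proj g x \<noteq> 0} \<union> {g. proj g y \<noteq> 0}"
  have fin: "finite ?S" using finite_proj by blast
  have sub: "{g. proj g x + proj g y \<noteq> 0} \<subseteq> ?S" by auto
  show "finite {g. proj g x + proj g y \<noteq> 0}" using fin sub by (rule rev_finite_subset)
  show "proj g x + proj g y \<in> Gr g" for g by (intro add_Gr proj_Gr)
  have "x = (\<Sum>g\<in>?S. proj g x)"
    by (subst sum_proj[symmetric], rule sum.mono_neutral_left[OF fin]) auto
  moreover have "y = (\<Sum>g\<in>?S. proj g y)"
    by (subst sum_proj[symmetric], rule sum.mono_neutral_left[OF fin]) auto
  ultimately have "x + y = (\<Sum>g\<in>?S. proj g x + proj g y)" by (simp add: sum.distrib)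
  also have "\<dots> = (\<Sum>g | proj g x + proj g y \<noteq> 0. proj g x + proj g y)"
    by (rule sum.mono_neutral_right[OF fin sub]) auto
  finally show "x + y = \<dots>" .
qed

text \<open>Every vector is the finite sum of its components. The empty sum is covered by the first
  premise, since \<open>0\<close> lies in every \<open>Gr g\<close>.\<close>

lemma homogeneous_induct [case_names homogeneous add]:
  assumes "\<And>g x. x \<in> Gr g \<Longrightarrow> P x" and "\<And>x y. P x \<Longrightarrow> P y \<Longrightarrow> P (x + y)"
  shows "P x"
proof -
  have "P (\<Sum>g\<in>S. proj g x)" if "finite S" for S
    using that
  proof (induction S)
    case empty
    show ?case using assms(1)[OF zero_Gr] by simp
  next
    case (insert g S)
    then show ?case by (simp add: assms(2) assms(1)[OF proj_Gr])
  qed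
  from this[OF finite_proj[of x]] show ?thesis by (simp only: sum_proj)
qed

lemma exists_proj_nonzero: "x \<noteq> 0 \<Longrightarrow> \<exists>g. proj g x \<noteq> 0"
  by (rule ccontr) (use sum_proj[of x] in simp)

end

text \<open>Both sides are additive in \<open>x\<close>, so it suffices to compare them on
  homogeneous \<open>x\<close>. The instances used below are left and right multiplication by a
  homogeneous element.\<close>

lemma proj_graded_map:
  fixes f :: "'a::ab_group_add \<Rightarrow> 'b::ab_group_add" and k :: "'g::ab_group_add"
  assumes "graded_space s1 G1" "graded_space s2 G2"
    and add: "\<And>x y. f (x + y) = f x + f y"
    and gr: "\<And>g x. x \<in> G1 g \<Longrightarrow> f x \<in> G2 (k + g)"
  shows "graded_space.proj G2 (k + g) (f x) = f (graded_space.proj G1 g x)"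
proof -
  interpret X: graded_space s1 G1 by fact
  interpret Y: graded_space s2 G2 by fact
  have f0: "f 0 = 0" using add[of 0 0] by simp
  show ?thesis
  proof (induction x rule: X.homogeneous_induct)
    case (homogeneous h x)
    then show ?case
      by (simp add: Y.proj_homogeneous[OF gr] X.proj_homogeneous f0)
  next
    case (add x y)
    then show ?case by (simp add: assms(3) X.proj_add Y.proj_add)
  qed
qed

text \<open>Each law for the inverse follows by applying \<open>f\<close> to the claimed value and
  using injectivity on \<open>A\<close>; the closure premises ensure that this value lies in
  \<open>A\<close>. The general carrier serves both \<open>D\<close> and its endomorphism algebra
  \<open>End_alg act\<close>.\<close>

lemma graded_antiaut_inv_into:
  assumes "graded_antiaut A add mul scale Gr f"
    and add: "\<And>x y. x \<in> A \<Longrightarrow> y \<in> A \<Longrightarrow> add x y \<in> A"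
    and mul: "\<And>x y. x \<in> A \<Longrightarrow> y \<in> A \<Longrightarrow> mul x y \<in> A"
    and scale: "\<And>c x. x \<in> A \<Longrightarrow> scale c x \<in> A"
    and Gr: "\<And>g. Gr g \<subseteq> A"
  shows "graded_antiaut A add mul scale Gr (inv_into A f)"
proof -
  let ?i = "inv_into A f"
  have bij: "bij_betw f A A"
    and f: "\<And>x y. x \<in> A \<Longrightarrow> y \<in> A \<Longrightarrow> f (add x y) = add (f x) (f y)"
      "\<And>c x. x \<in> A \<Longrightarrow> f (scale c x) = scale c (f x)"
      "\<And>x y. x \<in> A \<Longrightarrow> y \<in> A \<Longrightarrow> f (mul x y) = mul (f y) (f x)"
      "\<And>g. f ` Gr g = Gr g"
    using assms(1) unfolding graded_antiaut_def by blast+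
  have inA: "?i x \<in> A" and fi: "f (?i x) = x" if "x \<in> A" for x
    using that bij by (auto simp: bij_betw_def inv_into_into f_inv_into_f)
  have i_eqI: "?i x = y" if "y \<in> A" "f y = x" for x y
    using that bij by (auto simp: bij_betw_def inv_into_f_f)
  have "?i ` Gr g = Gr g" for g
  proof -
    have "?i ` (f ` Gr g) = Gr g"
      using bij Gr by (auto simp: bij_betw_def inv_into_image_cancel)
    then show ?thesis by (simp only: f(4))
  qed
  then show ?thesis
    unfolding graded_antiaut_def
    using bij_betw_inv_into[OF bij]
    by (auto intro!: i_eqI add mul scale inA simp: f inA fi)
qed

section \<open>Products and components in a graded algebra\<close>

context graded_algebra
begin

lemma Gr_mult': "x \<in> Gr g \<Longrightarrow> y \<in> Gr h \<Longrightarrow> x * y \<in> Gr (h + g)"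
  using Gr_mult[of x g y h] by (simp add: add.commute)

lemma proj_mult_left:
  assumes "x \<in> Gr k"
  shows "proj (k + g) (x * y) = x * proj g y"
  by (rule proj_graded_map[OF graded_space_axioms graded_space_axioms])
    (auto simp: distrib_left intro: Gr_mult assms)

lemma proj_mult_right:
  assumes "x \<in> Gr k"
  shows "proj (k + g) (y * x) = proj g y * x"
  by (rule proj_graded_map[OF graded_space_axioms graded_space_axioms, of "\<lambda>y. y * x"])
    (auto simp: distrib_right intro: Gr_mult' assms)

text \<open>Comparing components of degree \<open>g\<close> in \<open>x * 1 = x\<close> for
  \<open>x\<close> of degree \<open>g\<close> shows that \<open>proj 0 1\<close> is a right
  identity, so it equals \<open>1\<close>.\<close>

lemma one_Gr: "1 \<in> Gr 0"
proof -
  have "x * proj 0 1 = x" for x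
  proof (induction x rule: homogeneous_induct)
    case (homogeneous g x)
    then show ?case using proj_mult_left[of x g 0 1] by (simp add: proj_homogeneous)
  qed (simp add: distrib_right)
  from this[of 1] show ?thesis using proj_Gr[of 0 1] by simp
qed

end

section \<open>Units and degree-preserving antiautomorphisms of a graded-division algebra\<close>

context graded_division_algebra
begin

lemma ring_inv_mult [simp]:
  assumes "d \<in> gr_units Gr"
  shows "d * ring_inv d = 1" "ring_inv d * d = 1"
  using ring_inv[OF gr_units_invertible[OF assms]] by auto

lemma ring_inv_cancel [simp]:
  assumes "d \<in> gr_units Gr"
  shows "d * (ring_inv d * x) = x" "ring_inv d * (d * x) = x"
  using ring_inv_mult[OF assms] by (simp_all add: mult.assoc[symmetric])

text \<open>Taking components of degree \<open>0\<close> in \<open>d * ring_inv d = 1\<close> shows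
  that the component of \<open>ring_inv d\<close> in degree \<open>- h\<close> is already a right
  inverse of \<open>d\<close>.\<close>

lemma ring_inv_Gr:
  assumes "d \<in> gr_units Gr" "d \<in> Gr h"
  shows "ring_inv d \<in> Gr (- h)"
proof -
  have "d * proj (- h) (ring_inv d) = 1"
    using proj_mult_left[OF assms(2), of "- h" "ring_inv d"] assms(1) one_Gr
    by (simp add: proj_homogeneous)
  then have "proj (- h) (ring_inv d) = ring_inv d"
    using ring_inv_cancel(2)[OF assms(1), of "proj (- h) (ring_inv d)"] by simp
  then show ?thesis using proj_Gr[of "- h" "ring_inv d"] by simp
qed

lemma D_antiautD:
  assumes "D_antiaut scale Gr f"
  shows "f (x + y) = f x + f y" "f (x * y) = f y * f x" "f (scale c x) = scale c (f x)"
    "bij f" "f ` Gr g = Gr g" "f 1 = 1" "f 0 = 0" "f (- x) = - f x"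
proof -
  show add: "f (x + y) = f x + f y" for x y
    using assms unfolding D_antiaut_def graded_antiaut_def by blast
  show mul: "f (x * y) = f y * f x" for x y
    using assms unfolding D_antiaut_def graded_antiaut_def by blast
  show "f (scale c x) = scale c (f x)" "f ` Gr g = Gr g"
    using assms unfolding D_antiaut_def graded_antiaut_def by blast+
  show bij: "bij f" using assms unfolding D_antiaut_def graded_antiaut_def by blast
  obtain z where "f z = 1" using bij by (metis bij_pointE)
  then show "f 1 = 1" using mul[of z 1] by simp
  show f0: "f 0 = 0" using add[of 0 0] by simp
  show "f (- x) = - f x" using add[of x "- x"] f0 by (simp add: eq_neg_iff_add_eq_0 add.commute)
qed

lemma D_antiaut_inv:
  assumes "D_antiaut scale Gr f"
  shows "D_antiaut scale Gr (inv f)"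
  using assms unfolding D_antiaut_def by (rule graded_antiaut_inv_into) auto

text \<open>The degrees \<open>h\<close> and \<open>- h\<close> of the two outer factors cancel
  because the grading group is abelian.\<close>

lemma inner_aut_Gr:
  assumes "d \<in> gr_units Gr" "x \<in> Gr g"
  shows "inner_aut d x \<in> Gr g"
proof -
  obtain h where h: "d \<in> Gr h" using assms(1) unfolding gr_units_def by blast
  show ?thesis
    using Gr_mult[OF Gr_mult[OF h assms(2)] ring_inv_Gr[OF assms(1) h]]
    by (simp add: inner_aut_def)
qed

lemma D_antiaut_inner_aut_comp:
  assumes f: "D_antiaut scale Gr f" and d: "d \<in> gr_units Gr"
  shows "D_antiaut scale Gr (inner_aut d \<circ> f)"
proof -
  let ?j = "\<lambda>x. ring_inv d * x * d"
  obtain h where h: "d \<in> Gr h" using d unfolding gr_units_def by blast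
  have ji: "?j (inner_aut d x) = x" and ij: "inner_aut d (?j x) = x" for x
    using d by (simp_all add: inner_aut_def mult.assoc)
  have bij: "bij (inner_aut d)" by (rule o_bij[of ?j]) (auto simp: ji ij)
  have j_Gr: "?j x \<in> Gr g" if "x \<in> Gr g" for x g
    using Gr_mult[OF Gr_mult[OF ring_inv_Gr[OF d h] that] h] by simp
  have im: "inner_aut d ` Gr g = Gr g" for g
  proof
    show "inner_aut d ` Gr g \<subseteq> Gr g" using inner_aut_Gr[OF d] by auto
    show "Gr g \<subseteq> inner_aut d ` Gr g" by (rule subsetI) (metis ij j_Gr imageI)
  qed
  show ?thesis
    unfolding D_antiaut_def graded_antiaut_def
  proof (intro conjI ballI allI)
    show "bij (inner_aut d \<circ> f)" using bij_comp[OF D_antiautD(4)[OF f] bij] .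
    show "(inner_aut d \<circ> f) ` Gr g = Gr g" for g
      unfolding image_comp[symmetric] by (simp only: D_antiautD(5)[OF f] im)
  qed (use d in \<open>simp_all add: D_antiautD[OF f] inner_aut_def distrib_left distrib_right
      scale_mult_left scale_mult_right mult.assoc\<close>)
qed

text \<open>Any nonzero component \<open>proj g u\<close> works: for \<open>x\<close> of degree
  \<open>h\<close>, the components of degree \<open>h + g\<close> in
  \<open>inner_aut u x * u = u * x\<close> give the same relation with the right factor
  \<open>u\<close> and the left factor \<open>u\<close> both replaced by
  \<open>proj g u\<close>.\<close>

lemma inner_aut_homogeneous:
  assumes u: "invertible_elt u" and pres: "\<And>g x. x \<in> Gr g \<Longrightarrow> inner_aut u x \<in> Gr g"
  shows "\<exists>d\<in>gr_units Gr. inner_aut u = inner_aut d"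
proof -
  obtain y where "u * y = 1" using u unfolding invertible_elt_def by blast
  then have "u \<noteq> 0" by auto
  then obtain g where g: "proj g u \<noteq> 0" using exists_proj_nonzero by blast
  then have d: "proj g u \<in> gr_units Gr" unfolding gr_units_def using proj_Gr by blast
  have "inner_aut u x * proj g u = proj g u * x" for x
  proof (induction x rule: homogeneous_induct)
    case (homogeneous h x)
    have "inner_aut u x * proj g u = proj (h + g) (inner_aut u x * u)"
      by (rule proj_mult_left[symmetric, OF pres[OF homogeneous]])
    also have "\<dots> = proj (h + g) (u * x)" by (simp only: inner_aut_mult[OF u])
    also have "\<dots> = proj g u * x" by (rule proj_mult_right[OF homogeneous])
    finally show ?case .
  next
    case (add x y)
    have "inner_aut u (x + y) = inner_aut u x + inner_aut u y"
      by (simp add: inner_aut_def distrib_left distrib_right)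
    with add show ?case by (simp add: distrib_left distrib_right)
  qed
  then have "inner_aut u = inner_aut (proj g u)"
    by (intro ext inner_aut_eqI[OF gr_units_invertible[OF d]])
  with d show ?thesis by blast
qed

end

section \<open>Functionals and rank-one maps on the module\<close>

locale graded_division_module = graded_right_module sD Dg sV Vg act +
  D: graded_division_algebra sD Dg
  for sD :: "'f::field \<Rightarrow> 'd::ring_1 \<Rightarrow> 'd" and Dg :: "'g::ab_group_add \<Rightarrow> 'd set"
    and sV :: "'f \<Rightarrow> 'v::ab_group_add \<Rightarrow> 'v" and Vg :: "'g \<Rightarrow> 'v set"
    and act :: "'v \<Rightarrow> 'd \<Rightarrow> 'v" +
  assumes nontrivial: "\<exists>v::'v. v \<noteq> 0"
begin

lemma act_zero_right [simp]: "act v 0 = 0"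
  using act_add_right[of v 0 0] by simp

lemma act_zero_left [simp]: "act 0 d = 0"
  using act_add_left[of 0 0 d] by simp

lemma act_sum_left: "act (\<Sum>x\<in>S. f x) d = (\<Sum>x\<in>S. act (f x) d)"
  by (induction S rule: infinite_finite_induct) (auto simp: act_add_left)

text \<open>Scalars act through the central elements \<open>sD c 1\<close>; this makes maps
  commuting with \<open>act\<close> commute with scalars of the base field as well.\<close>

lemma sV_eq_act: "sV c v = act v (sD c 1)"
  by (simp add: act_scale_right act_one)

lemma exists_homogeneous: "\<exists>g. \<exists>v\<in>Vg g. v \<noteq> 0"
  using nontrivial V.exists_proj_nonzero V.proj_Gr by meson

definition dual :: "('v \<Rightarrow> 'd) set" where
  "dual = {f. (\<forall>v w. f (v + w) = f v + f w) \<and> (\<forall>v d. f (act v d) = f v * d)}"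

lemma dualD:
  assumes "f \<in> dual"
  shows "f (v + w) = f v + f w" "f (act v d) = f v * d" "f 0 = 0"
proof -
  show add: "f (v + w) = f v + f w" for v w using assms unfolding dual_def by blast
  show "f (act v d) = f v * d" using assms unfolding dual_def by blast
  show "f 0 = 0" using add[of 0 0] by simp
qed

lemma End_algD:
  assumes "r \<in> End_alg act"
  shows "r (v + w) = r v + r w" "r (act v d) = act (r v) d" "r 0 = 0" "r (sV c v) = sV c (r v)"
proof -
  show add: "r (v + w) = r v + r w" for v w using assms unfolding End_alg_def by blast
  show "r 0 = 0" using add[of 0 0] by simp
  show "r (act v d) = act (r v) d" for d using assms unfolding End_alg_def by blast
  then show "r (sV c v) = sV c (r v)" unfolding sV_eq_act .
qed

text \<open>These maps play the role of matrix units; \<open>comp_rank_one\<close> and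
  \<open>rank_one_comp\<close> are their multiplication rules.\<close>

definition rank_one :: "'v \<Rightarrow> ('v \<Rightarrow> 'd) \<Rightarrow> 'v \<Rightarrow> 'v" where
  "rank_one w f x = act w (f x)"

lemma rank_one_End_alg: "f \<in> dual \<Longrightarrow> rank_one w f \<in> End_alg act"
  unfolding End_alg_def by (auto simp: rank_one_def dualD act_add_right act_mult)

lemma comp_rank_one:
  assumes "r \<in> End_alg act"
  shows "r \<circ> rank_one w f = rank_one (r w) f"
  by (rule ext) (simp add: rank_one_def End_algD[OF assms])

lemma rank_one_comp:
  assumes "f \<in> dual"
  shows "rank_one v f \<circ> rank_one w h = rank_one (act v (f w)) h"
  by (rule ext) (simp add: rank_one_def dualD[OF assms] act_mult)

lemma End_alg_comp: "r \<in> End_alg act \<Longrightarrow> s \<in> End_alg act \<Longrightarrow> r \<circ> s \<in> End_alg act"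
  and End_alg_add: "r \<in> End_alg act \<Longrightarrow> s \<in> End_alg act \<Longrightarrow> (\<lambda>v. r v + s v) \<in> End_alg act"
  and End_alg_scale: "r \<in> End_alg act \<Longrightarrow> (\<lambda>v. sV c (r v)) \<in> End_alg act"
  and End_alg_id: "id \<in> End_alg act"
  by (auto simp: End_alg_def act_add_left V.scale_right_distrib act_scale_left)

lemma End_gr_End_alg: "r \<in> End_gr act Vg g \<Longrightarrow> r \<in> End_alg act"
  unfolding End_gr_def by blast

lemma End_grD: "r \<in> End_gr act Vg g \<Longrightarrow> v \<in> Vg h \<Longrightarrow> r v \<in> Vg (g + h)"
  unfolding End_gr_def by blast

lemma rank_one_End_gr:
  assumes "f \<in> dual" "\<And>b x. x \<in> Vg b \<Longrightarrow> f x \<in> Dg (k + b)" "w \<in> Vg a"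
  shows "rank_one w f \<in> End_gr act Vg (a + k)"
  unfolding End_gr_def
  using rank_one_End_alg[OF assms(1)] act_Gr[OF assms(3) assms(2)]
  by (auto simp: rank_one_def add.assoc)

lemma End_antiautD:
  assumes "End_antiaut sV Vg act f"
  shows "bij_betw f (End_alg act) (End_alg act)"
    and "r \<in> End_alg act \<Longrightarrow> s \<in> End_alg act \<Longrightarrow> f (\<lambda>v. r v + s v) = (\<lambda>v. f r v + f s v)"
    and "r \<in> End_alg act \<Longrightarrow> f (\<lambda>v. sV c (r v)) = (\<lambda>v. sV c (f r v))"
    and "r \<in> End_alg act \<Longrightarrow> s \<in> End_alg act \<Longrightarrow> f (r \<circ> s) = f s \<circ> f r"
    and "r \<in> End_gr act Vg g \<Longrightarrow> f r \<in> End_gr act Vg g"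
    and "r \<in> End_alg act \<Longrightarrow> f r \<in> End_alg act"
proof -
  show bij: "bij_betw f (End_alg act) (End_alg act)"
    using assms unfolding End_antiaut_def graded_antiaut_def by blast
  then show "r \<in> End_alg act \<Longrightarrow> f r \<in> End_alg act" by (rule bij_betw_apply)
qed (use assms in \<open>unfold End_antiaut_def graded_antiaut_def, blast+\<close>)

lemma End_antiaut_inv_into:
  assumes "End_antiaut sV Vg act f"
  shows "End_antiaut sV Vg act (inv_into (End_alg act) f)"
  using assms unfolding End_antiaut_def
  by (rule graded_antiaut_inv_into)
    (auto intro: End_alg_add End_alg_comp End_alg_scale End_gr_End_alg)

text \<open>The functionals are the coordinates of a basis. Uniqueness of coefficients makes them
  additive and right linear over \<open>D\<close>, because sums and right multiples of coefficient
  families represent the sums and multiples of the vectors.\<close>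

lemma dual_basis:
  assumes "finite_rank act"
  shows "\<exists>S f. finite S \<and> (\<forall>x\<in>S. f x \<in> dual) \<and> (\<forall>v. (\<Sum>x\<in>S. act x (f x v)) = v)"
proof -
  obtain S where S: "finite S"
    and ex1: "\<And>v. \<exists>!c. (\<forall>x. x \<notin> S \<longrightarrow> c x = 0) \<and> v = (\<Sum>x\<in>S. act x (c x))"
    using assms unfolding finite_rank_def by blast
  define co where "co v = (THE c. (\<forall>x. x \<notin> S \<longrightarrow> c x = 0) \<and> v = (\<Sum>x\<in>S. act x (c x)))" for v
  have co: "(\<forall>x. x \<notin> S \<longrightarrow> co v x = 0) \<and> v = (\<Sum>x\<in>S. act x (co v x))" for v
    unfolding co_def by (rule theI'[OF ex1])
  have co_unique: "co v = c"
    if "\<forall>x. x \<notin> S \<longrightarrow> c x = 0" "v = (\<Sum>x\<in>S. act x (c x))" for v c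
    using the1_equality[OF ex1] that unfolding co_def by blast
  have "co (v + w) = (\<lambda>x. co v x + co w x)" for v w
  proof (rule co_unique)
    have "v + w = (\<Sum>x\<in>S. act x (co v x)) + (\<Sum>x\<in>S. act x (co w x))" using co by metis
    then show "v + w = (\<Sum>x\<in>S. act x (co v x + co w x))"
      by (simp add: act_add_right sum.distrib)
  qed (simp add: co)
  moreover have "co (act v d) = (\<lambda>x. co v x * d)" for v d
  proof (rule co_unique)
    have "act v d = act (\<Sum>x\<in>S. act x (co v x)) d" using co by metis
    then show "act v d = (\<Sum>x\<in>S. act x (co v x * d))"
      by (simp add: act_mult act_sum_left)
  qed (simp add: co)
  ultimately have "(\<lambda>v. co v x) \<in> dual" for x by (simp add: dual_def)
  moreover have "(\<Sum>x\<in>S. act x (co v x)) = v" for v using co by metis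
  ultimately show ?thesis using S by (intro exI[of _ S] exI[of _ "\<lambda>x v. co v x"]) auto
qed

text \<open>The component of degree \<open>k\<close> of \<open>f\<close> in the dual module: on
  \<open>Vg a\<close> it is \<open>f\<close> followed by projection to degree
  \<open>k + a\<close>.\<close>

definition dual_part :: "'g \<Rightarrow> ('v \<Rightarrow> 'd) \<Rightarrow> 'v \<Rightarrow> 'd" where
  "dual_part k f v = (\<Sum>a | V.proj a v \<noteq> 0. D.proj (k + a) (f (V.proj a v)))"

lemma D_proj_zero [simp]: "D.proj g 0 = 0"
  using D.proj_homogeneous[OF D.zero_Gr] by simp

lemma dual_part_superset:
  assumes "f \<in> dual" "finite S" "{a. V.proj a v \<noteq> 0} \<subseteq> S"
  shows "dual_part k f v = (\<Sum>a\<in>S. D.proj (k + a) (f (V.proj a v)))"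
  unfolding dual_part_def
  by (rule sum.mono_neutral_left[OF assms(2,3)]) (auto simp: dualD[OF assms(1)])

lemma dual_part_homogeneous:
  assumes "f \<in> dual" "v \<in> Vg a"
  shows "dual_part k f v = D.proj (k + a) (f v)"
proof -
  have "dual_part k f v = (\<Sum>a\<in>{a}. D.proj (k + a) (f (V.proj a v)))"
    by (rule dual_part_superset[OF assms(1)]) (auto simp: V.proj_homogeneous[OF assms(2)] split: if_splits)
  then show ?thesis by (simp add: V.proj_homogeneous[OF assms(2)])
qed

lemma dual_part_add:
  assumes "f \<in> dual"
  shows "dual_part k f (v + w) = dual_part k f v + dual_part k f w"
proof -
  let ?S = "{a. V.proj a v \<noteq> 0} \<union> {a. V.proj a w \<noteq> 0}"
  have fin: "finite ?S" using V.finite_proj by blast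
  show ?thesis
    by (subst (1 2 3) dual_part_superset[OF assms fin])
      (auto simp: V.proj_add dualD[OF assms] D.proj_add sum.distrib)
qed

text \<open>It suffices to take homogeneous \<open>v\<close> and \<open>d\<close>. Right
  multiplication by \<open>d\<close> of degree \<open>h\<close> commutes with projection up to a
  shift by \<open>h\<close>, which matches the shift in the degree of
  \<open>act v d\<close>.\<close>

lemma dual_part_dual:
  assumes f: "f \<in> dual"
  shows "dual_part k f \<in> dual"
proof -
  have "dual_part k f (act v d) = dual_part k f v * d" for v d
  proof (induction v rule: V.homogeneous_induct)
    case (homogeneous a v)
    show ?case
    proof (induction d rule: D.homogeneous_induct)
      case (homogeneous h d)
      have "dual_part k f (act v d) = D.proj (h + (k + a)) (f v * d)"
        using dual_part_homogeneous[OF f act_Gr[OF \<open>v \<in> Vg a\<close> homogeneous], of k]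
        by (simp add: dualD[OF f] ac_simps)
      also have "\<dots> = dual_part k f v * d"
        by (simp only: D.proj_mult_right[OF homogeneous] dual_part_homogeneous[OF f \<open>v \<in> Vg a\<close>])
      finally show ?case .
    qed (simp add: act_add_right dual_part_add[OF f] distrib_left)
  qed (simp add: act_add_left dual_part_add[OF f] distrib_right)
  then show ?thesis using dual_part_add[OF f] unfolding dual_def by blast
qed

text \<open>Scaling a suitable homogeneous component of a coordinate functional avoids the existence of a
  homogeneous basis.\<close>

lemma exists_dual_homogeneous:
  assumes "finite_rank act" and v: "v \<in> Vg a" "v \<noteq> 0"
  shows "\<exists>f\<in>dual. f v = 1 \<and> (\<forall>b. \<forall>x\<in>Vg b. f x \<in> Dg (- a + b))"
proof -
  obtain S f where S: "finite S" "\<And>x. x \<in> S \<Longrightarrow> f x \<in> dual" "(\<Sum>x\<in>S. act x (f x v)) = v"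
    using dual_basis[OF assms(1)] by blast
  have "\<exists>x\<in>S. f x v \<noteq> 0"
  proof (rule ccontr)
    assume "\<not> ?thesis"
    then have "(\<Sum>x\<in>S. act x (f x v)) = 0" by (intro sum.neutral) simp
    then show False using S(3) v(2) by simp
  qed
  then obtain x where x: "f x \<in> dual" "f x v \<noteq> 0" using S(2) by blast
  obtain k where k: "D.proj k (f x v) \<noteq> 0" using D.exists_proj_nonzero[OF x(2)] by blast
  \<comment> \<open>The index \<open>k - a\<close> is chosen so that at \<open>v\<close>, of degree
    \<open>a\<close>, the value is the nonzero component of degree \<open>k\<close>.\<close>
  define h where "h = dual_part (k - a) (f x)"
  have h: "h \<in> dual" unfolding h_def by (rule dual_part_dual[OF x(1)])
  have hv: "h v = D.proj k (f x v)"
    using dual_part_homogeneous[OF x(1) v(1), of "k - a"] by (simp add: h_def)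
  have e: "h v \<in> gr_units Dg" "h v \<in> Dg k"
    using k D.proj_Gr unfolding hv gr_units_def by blast+
  have hgr: "h y \<in> Dg (k - a + b)" if "y \<in> Vg b" for y b
    using dual_part_homogeneous[OF x(1) that] D.proj_Gr unfolding h_def by simp
  \<comment> \<open>Normalizing by a left factor keeps right linearity; its degree
    \<open>- k\<close> turns the degree \<open>k - a\<close> of \<open>h\<close> into
    \<open>- a\<close>.\<close>
  show ?thesis
  proof (intro bexI[of _ "\<lambda>y. ring_inv (h v) * h y"] conjI allI ballI)
    show "(\<lambda>y. ring_inv (h v) * h y) \<in> dual"
      unfolding dual_def by (auto simp: dualD[OF h] distrib_left mult.assoc)
    show "ring_inv (h v) * h v = 1" using e by simp
    show "ring_inv (h v) * h y \<in> Dg (- a + b)" if "y \<in> Vg b" for y b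
      using D.Gr_mult[OF D.ring_inv_Gr[OF e] hgr[OF that]] by (simp add: algebra_simps)
  qed
qed

lemma linear_sV_sD:
  assumes "\<And>v w. f (v + w) = f v + f w" "\<And>c v. f (sV c v) = sD c (f v)"
  shows "Vector_Spaces.linear sV sD f"
  using assms V.vector_space_axioms D.vector_space_axioms
  by (simp add: Vector_Spaces.linear_iff)

section \<open>Elimination and introduction rules for adjoint pairs\<close>

lemma adjoint_pairD:
  assumes "adjoint_pair sD Dg sV Vg act \<phi> \<phi>0 B"
  shows "D_antiaut sD Dg \<phi>0"
    and "B (v + v') w = B v w + B v' w" "B v (w + w') = B v w + B v w'"
    and "B (act v d) w = \<phi>0 d * B v w" "B v (act w d) = B v w * d"
    and "B (sV c v) w = sD c (B v w)" "B v (sV c w) = sD c (B v w)"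
    and "(\<And>w. B v w = 0) \<Longrightarrow> v = 0" "(\<And>v. B v w = 0) \<Longrightarrow> w = 0"
    and "B v \<in> dual"
    and "r \<in> End_alg act \<Longrightarrow> B (r v) w = B v (\<phi> r w)"
    and "\<exists>g0. \<forall>a b. \<forall>v\<in>Vg a. \<forall>w\<in>Vg b. B v w \<in> Dg (g0 + a + b)"
proof -
  have lin: "Vector_Spaces.linear sV sD (\<lambda>v. B v w)" "Vector_Spaces.linear sV sD (B v)" for v w
    using assms unfolding adjoint_pair_def bilinear_map_def by blast+
  show "B (v + v') w = B v w + B v' w" "B (sV c v) w = sD c (B v w)" "B v (sV c w) = sD c (B v w)"
    and add: "B v (w + w') = B v w + B v w'" for v w w'
    using lin[of w] lin(2)[of v] by (auto simp: Vector_Spaces.linear_iff)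
  show "B (act v d) w = \<phi>0 d * B v w"
    using assms unfolding adjoint_pair_def sesquilinear_def by blast
  show act: "B v (act w d) = B v w * d" for w d
    using assms unfolding adjoint_pair_def sesquilinear_def by blast
  show "B v \<in> dual" using act add unfolding dual_def by blast
  show "D_antiaut sD Dg \<phi>0" "(\<And>w. B v w = 0) \<Longrightarrow> v = 0" "(\<And>v. B v w = 0) \<Longrightarrow> w = 0"
    "r \<in> End_alg act \<Longrightarrow> B (r v) w = B v (\<phi> r w)"
    "\<exists>g0. \<forall>a b. \<forall>v\<in>Vg a. \<forall>w\<in>Vg b. B v w \<in> Dg (g0 + a + b)"
    using assms
    unfolding adjoint_pair_def nondegenerate_def adjunction_def homogeneous_form_def by blast+
qed

text \<open>Bilinearity over the base field is obtained from sesquilinearity, because scalars act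
  through \<open>sD c 1\<close> and \<open>\<phi>0\<close> fixes these elements.\<close>

lemma adjoint_pairI:
  assumes "D_antiaut sD Dg \<phi>0"
    and "\<And>v v' w. B (v + v') w = B v w + B v' w" "\<And>v w w'. B v (w + w') = B v w + B v w'"
    and "\<And>d v w. B (act v d) w = \<phi>0 d * B v w" "\<And>d v w. B v (act w d) = B v w * d"
    and "\<And>v. (\<And>w. B v w = 0) \<Longrightarrow> v = 0" "\<And>w. (\<And>v. B v w = 0) \<Longrightarrow> w = 0"
    and "\<And>r v w. r \<in> End_alg act \<Longrightarrow> B (r v) w = B v (\<phi> r w)"
    and "\<And>a b v w. v \<in> Vg a \<Longrightarrow> w \<in> Vg b \<Longrightarrow> B v w \<in> Dg (g0 + a + b)"
  shows "adjoint_pair sD Dg sV Vg act \<phi> \<phi>0 B"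
proof -
  have "B v (sV c w) = sD c (B v w)" for c v w
    by (simp add: sV_eq_act assms(5) D.scale_mult_right)
  moreover have "B (sV c v) w = sD c (B v w)" for c v w
    using D.D_antiautD(3,6)[OF assms(1)]
    by (simp add: sV_eq_act assms(4) D.scale_mult_left)
  ultimately have "bilinear_map sV sD B"
    unfolding bilinear_map_def by (auto intro!: linear_sV_sD simp: assms(2,3))
  then show ?thesis
    unfolding adjoint_pair_def nondegenerate_def adjunction_def homogeneous_form_def sesquilinear_def
    by (intro conjI exI[of _ g0]) (auto intro: assms(1,6,7,9) simp: assms(4,5,8))
qed

section \<open>Existence of the sesquilinear form\<close>

lemma exists_adjoint_pair:
  assumes fr: "finite_rank act" and \<phi>: "End_antiaut sV Vg act \<phi>"
  shows "\<exists>\<phi>0 B. adjoint_pair sD Dg sV Vg act \<phi> \<phi>0 B"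
proof -
  define \<psi> where "\<psi> = inv_into (End_alg act) \<phi>"
  have \<psi>: "End_antiaut sV Vg act \<psi>" unfolding \<psi>_def by (rule End_antiaut_inv_into[OF \<phi>])
  note \<phi>D = End_antiautD[OF \<phi>] and \<psi>D = End_antiautD[OF \<psi>]
  have \<phi>\<psi>: "\<phi> (\<psi> r) = r" and \<psi>\<phi>: "\<psi> (\<phi> r) = r" if "r \<in> End_alg act" for r
    using that \<phi>D(1) by (auto simp: \<psi>_def bij_betw_def f_inv_into_f inv_into_f_f)
  obtain a0 v0 where v0: "v0 \<in> Vg a0" "v0 \<noteq> 0" using exists_homogeneous by blast
  obtain l where l: "l \<in> dual" "l v0 = 1" and l_gr: "\<And>b x. x \<in> Vg b \<Longrightarrow> l x \<in> Dg (- a0 + b)"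
    using exists_dual_homogeneous[OF fr v0] by blast
  \<comment> \<open>Because \<open>l v0 = 1\<close>, evaluation at \<open>v0\<close> recovers
    \<open>w\<close> from \<open>rank_one w l\<close>, hence \<open>s w\<close> determines
    \<open>w\<close>.\<close>
  define s where "s w = \<psi> (rank_one w l)" for w
  have R: "rank_one w l \<in> End_alg act" for w by (rule rank_one_End_alg[OF l(1)])
  have s_End: "s w \<in> End_alg act" for w unfolding s_def by (rule \<psi>D(6)[OF R])
  have \<phi>s: "\<phi> (s w) = rank_one w l" for w unfolding s_def by (rule \<phi>\<psi>[OF R])
  have s_gr: "s w \<in> End_gr act Vg (b + - a0)" if "w \<in> Vg b" for w b
    unfolding s_def by (intro \<psi>D(5) rank_one_End_gr l(1) l_gr that)
  have s_add: "s (w + w') v = s w v + s w' v" for w w' v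
  proof -
    have "rank_one (w + w') l = (\<lambda>v. rank_one w l v + rank_one w' l v)"
      by (rule ext) (simp add: rank_one_def act_add_left)
    then show ?thesis unfolding s_def using \<psi>D(2)[OF R R] by simp
  qed
  have s_zero: "w = 0" if "s w = s 0" for w
  proof -
    have "rank_one w l v0 = rank_one 0 l v0" using that \<phi>s by metis
    then show "w = 0" by (simp add: rank_one_def l(2) act_one)
  qed
  have s0: "s 0 v = 0" for v using s_add[of 0 0 v] by simp
  \<comment> \<open>\<open>\<psi>\<close> reverses products, so the right action on \<open>w\<close>
    becomes left multiplication by \<open>s (act v0 d)\<close>.\<close>
  have s_act: "s (act w d) v = s (act v0 d) (s w v)" for w d v
  proof -
    have "rank_one (act w d) l = rank_one w l \<circ> rank_one (act v0 d) l"
      by (simp add: rank_one_comp[OF l(1)] dualD[OF l(1)] l(2))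
    then have "s (act w d) = s (act v0 d) \<circ> s w" unfolding s_def by (simp add: \<psi>D(4)[OF R R])
    then show ?thesis by simp
  qed
  \<comment> \<open>This becomes the adjunction identity for the form.\<close>
  have s_comp: "s (\<phi> r w) v = s w (r v)" if "r \<in> End_alg act" for r w v
  proof -
    have "s (\<phi> r w) = \<psi> (\<phi> r \<circ> rank_one w l)"
      unfolding s_def by (simp add: comp_rank_one[OF \<phi>D(6)[OF that]])
    also have "\<dots> = s w \<circ> r"
      unfolding s_def by (simp add: \<psi>D(4)[OF \<phi>D(6)[OF that] R] \<psi>\<phi>[OF that])
    finally show ?thesis by simp
  qed
  let ?q = "s v0"
  \<comment> \<open>The case \<open>d = 1\<close> of \<open>s_act\<close>: the idempotent
    \<open>?q\<close> fixes the image of every \<open>s w\<close> pointwise.\<close>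
  have q_s: "?q (s w v) = s w v" for w v using s_act[of w 1 v] by (simp add: act_one)
  obtain a1 u where u: "u \<in> Vg a1" "u \<noteq> 0" "?q u = u"
  proof -
    have "\<exists>a. \<exists>v\<in>Vg a. ?q v \<noteq> 0"
    proof (rule ccontr)
      assume *: "\<not> ?thesis"
      have "?q v = 0" for v
        by (induction v rule: V.homogeneous_induct) (use * End_algD[OF s_End] in auto)
      then have "s v0 = s 0" using s0 by (intro ext) simp
      then show False using s_zero v0(2) by blast
    qed
    then obtain a v where v: "v \<in> Vg a" "?q v \<noteq> 0" by blast
    show ?thesis
      using that[of "?q v" "a0 + - a0 + a"] End_grD[OF s_gr[OF v0(1)] v(1)] v(2) q_s by blast
  qed
  obtain m where m: "m \<in> dual" "m u = 1" and m_gr: "\<And>b x. x \<in> Vg b \<Longrightarrow> m x \<in> Dg (- a1 + b)"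
    using exists_dual_homogeneous[OF fr u(1,2)] by blast
  \<comment> \<open>\<open>\<epsilon> d\<close> is the coefficient left over when
    \<open>\<phi> (rank_one (act u d) m)\<close> is compressed by \<open>rank_one v0 l\<close> on
    both sides. It supplies preimages under the map \<open>\<theta>\<close> introduced
    below.\<close>
  define \<epsilon> where "\<epsilon> d = l (\<phi> (rank_one (act u d) m) v0)" for d
  have M: "rank_one w m \<in> End_alg act" for w by (rule rank_one_End_alg[OF m(1)])
  have s_\<epsilon>: "s (act v0 (\<epsilon> d)) x = ?q (act (act u d) (m (?q x)))" for d x
  proof -
    let ?r = "rank_one (act u d) m"
    have "\<phi> (?q \<circ> (?r \<circ> ?q)) = rank_one v0 l \<circ> \<phi> ?r \<circ> rank_one v0 l"
      using s_End M by (simp add: \<phi>D(4) End_alg_comp \<phi>s)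
    also have "\<dots> = rank_one (act v0 (\<epsilon> d)) l"
      by (simp add: comp_assoc comp_rank_one[OF \<phi>D(6)[OF M]] rank_one_comp[OF l(1)] \<epsilon>_def)
    finally have "s (act v0 (\<epsilon> d)) = ?q \<circ> (?r \<circ> ?q)"
      unfolding s_def using \<psi>\<phi> End_alg_comp M s_End s_def by metis
    then show ?thesis by (simp add: rank_one_def)
  qed
  have \<epsilon>_gr: "\<epsilon> d \<in> Dg h" if "d \<in> Dg h" for d h
  proof -
    have "rank_one (act u d) m \<in> End_gr act Vg ((a1 + h) + - a1)"
      by (intro rank_one_End_gr m(1) m_gr act_Gr u(1) that)
    from l_gr[OF End_grD[OF \<phi>D(5)[OF this] v0(1)]] show ?thesis unfolding \<epsilon>_def by simp
  qed
  have s_\<epsilon>_u: "s (act v0 (\<epsilon> d)) u = act u d" for d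
    by (simp add: s_\<epsilon> u(3) m(2) act_one End_algD[OF s_End])
  have \<epsilon>1: "\<epsilon> 1 \<in> gr_units Dg"
  proof -
    have "\<epsilon> 1 \<noteq> 0" using s_\<epsilon>_u[of 1] u(2) s0 by (auto simp: act_one)
    then show ?thesis using \<epsilon>_gr[OF D.one_Gr] unfolding gr_units_def by blast
  qed
  \<comment> \<open>Dividing by the unit \<open>\<epsilon> 1\<close> writes \<open>?q\<close> as
    \<open>s (act v0 (\<epsilon> 1))\<close> after another map; by \<open>s_\<epsilon>\<close> the
    former takes values in the submodule generated by \<open>u\<close>.\<close>
  have q_u: "?q x = act u (m (?q x))" for x
  proof -
    let ?y = "s (act v0 (ring_inv (\<epsilon> 1))) x"
    have "?q x = s (act v0 (\<epsilon> 1)) ?y"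
      using s_act[of "act v0 (ring_inv (\<epsilon> 1))" "\<epsilon> 1" x] \<epsilon>1
      by (simp add: act_mult[symmetric] act_one)
    also have "\<dots> = act u (m (?q ?y))"
      by (simp add: s_\<epsilon> act_one End_algD[OF s_End] u(3))
    finally have "?q x = act u (m (?q ?y))" .
    then show ?thesis by (simp add: dualD[OF m(1)] m(2))
  qed
  \<comment> \<open>The functional \<open>m\<close> reads off the coefficient at \<open>u\<close>.
    This form is linear in the first argument and twisted by \<open>\<theta>\<close> in the second;
    applying \<open>inv \<theta>\<close> at the end restores the required convention.\<close>
  define b where "b v w = m (s w v)" for v w
  have s_b: "s w v = act u (b v w)" for w v
    using q_u[of "s w v"] by (simp add: q_s b_def)
  \<comment> \<open>\<open>s (act v0 d)\<close> sends \<open>u\<close> to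
    \<open>act u (\<theta> d)\<close>; since \<open>s\<close> reverses the order of factors,
    \<open>\<theta>\<close> is anti-multiplicative.\<close>
  define \<theta> where "\<theta> d = b u (act v0 d)" for d
  have b_act_left: "b (act v d) w = b v w * d" for v d w
    by (simp add: b_def End_algD[OF s_End] dualD[OF m(1)])
  have b_act_right: "b v (act w d) = \<theta> d * b v w" for v d w
  proof -
    have "b v (act w d) = m (s (act v0 d) (act u (b v w)))"
      by (simp only: b_def[of v "act w d"] s_act[of w d v] s_b[of w v])
    then show ?thesis
      by (simp add: End_algD[OF s_End] dualD[OF m(1)] \<theta>_def b_def[of u])
  qed
  have b_add_left: "b (v + v') w = b v w + b v' w" for v v' w
    by (simp add: b_def End_algD[OF s_End] dualD[OF m(1)])
  have b_add_right: "b v (w + w') = b v w + b v w'" for v w w'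
    by (simp add: b_def s_add dualD[OF m(1)])
  have b_gr: "b v w \<in> Dg (- a1 + (c + - a0 + a))" if "v \<in> Vg a" "w \<in> Vg c" for v w a c
    unfolding b_def by (intro m_gr End_grD[OF s_gr] that)
  have \<theta>_gr: "\<theta> d \<in> Dg h" if "d \<in> Dg h" for d h
    using b_gr[OF u(1) act_Gr[OF v0(1) that]] unfolding \<theta>_def by (simp add: algebra_simps)
  have \<theta>_\<epsilon>: "\<theta> (\<epsilon> d) = d" for d
    by (simp add: \<theta>_def b_def s_\<epsilon>_u dualD[OF m(1)] m(2))
  have \<theta>_add: "\<theta> (d + e) = \<theta> d + \<theta> e" for d e
    by (simp add: \<theta>_def act_add_right b_add_right)
  have \<theta>_mult: "\<theta> (d * e) = \<theta> e * \<theta> d" for d e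
    using b_act_right[of u "act v0 d" e] by (simp add: \<theta>_def act_mult)
  \<comment> \<open>\<open>s (act v0 d)\<close> is unchanged by composing with \<open>?q\<close> on
    the right, and the image of \<open>?q\<close> is generated by \<open>u\<close>; so it vanishes
    as soon as it kills \<open>u\<close>.\<close>
  have \<theta>_zero: "d = 0" if "\<theta> d = 0" for d
  proof -
    have "s (act v0 d) x = 0" for x
    proof -
      have "s (act v0 d) u = 0" using s_b[of "act v0 d" u] that by (simp add: \<theta>_def)
      moreover have "s (act v0 d) x = s (act v0 d) (act u (m (?q x)))"
        using s_act[of v0 d x] by (simp only: q_u[symmetric])
      ultimately show ?thesis by (simp add: End_algD[OF s_End])
    qed
    then have "act v0 d = 0" using s0 by (intro s_zero ext) simp
    then have "l (act v0 d) = 0" by (simp add: dualD[OF l(1)])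
    then show ?thesis by (simp add: dualD[OF l(1)] l(2))
  qed
  have \<theta>: "D_antiaut sD Dg \<theta>"
    unfolding D_antiaut_def graded_antiaut_def
  proof (intro conjI allI ballI)
    have "inj \<theta>"
    proof (rule injI)
      fix d e assume "\<theta> d = \<theta> e"
      then have "\<theta> (d - e) = 0" using \<theta>_add[of "d - e" e] by simp
      then show "d = e" using \<theta>_zero by fastforce
    qed
    then show "bij \<theta>" using \<theta>_\<epsilon> unfolding bij_def by (metis surjI)
    show "\<theta> ` Dg g = Dg g" for g
    proof
      show "\<theta> ` Dg g \<subseteq> Dg g" using \<theta>_gr by blast
      show "Dg g \<subseteq> \<theta> ` Dg g" by (rule subsetI) (metis \<theta>_\<epsilon> \<epsilon>_gr imageI)
    qed
    show "\<theta> (sD c d) = sD c (\<theta> d)" for c d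
    proof -
      have c: "\<theta> (sD c 1) = sD c 1"
      proof -
        have "rank_one (act v0 (sD c 1)) l = (\<lambda>x. sV c (rank_one v0 l x))"
          by (rule ext) (simp add: rank_one_def act_scale_right act_scale_left act_one)
        then have "s (act v0 (sD c 1)) u = sV c (?q u)"
          unfolding s_def by (simp add: \<psi>D(3)[OF R])
        then show ?thesis
          by (simp add: \<theta>_def b_def u(3) sV_eq_act dualD[OF m(1)] m(2))
      qed
      have "\<theta> (sD c d) = \<theta> (d * sD c 1)" by (simp add: D.scale_mult_right)
      also have "\<dots> = sD c (\<theta> d)" by (simp only: \<theta>_mult c) (simp add: D.scale_mult_left)
      finally show ?thesis .
    qed
  qed (simp_all add: \<theta>_add \<theta>_mult)
  note \<theta>i = D.D_antiautD[OF D.D_antiaut_inv[OF \<theta>]]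
  have i\<theta>: "inv \<theta> (\<theta> d) = d" for d
    using D.D_antiautD(4)[OF \<theta>] by (simp add: bij_def)
  have \<theta>i_zero: "d = 0" if "inv \<theta> d = 0" for d
    using that D.D_antiautD(4,7)[OF \<theta>] by (metis bij_inv_eq_iff)
  \<comment> \<open>The next facts allow \<open>\<psi>\<close> to be applied to a decomposition of
    the identity into rank-one maps.\<close>
  have \<psi>_id: "\<psi> id = id"
    using \<psi>D(4)[OF End_alg_id \<phi>D(6)[OF End_alg_id]] \<psi>\<phi>[OF End_alg_id] by simp
  have \<psi>_zero: "\<psi> (\<lambda>v. 0) = (\<lambda>v. 0)"
  proof -
    have "rank_one 0 l = (\<lambda>v. 0)" by (rule ext) (simp add: rank_one_def)
    then show ?thesis using s0 unfolding s_def by (intro ext) metis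
  qed
  have zero_End: "(\<lambda>v. 0) \<in> End_alg act" by (simp add: End_alg_def)
  have \<psi>_sum: "(\<lambda>v. \<Sum>x\<in>S. r x v) \<in> End_alg act \<and> \<psi> (\<lambda>v. \<Sum>x\<in>S. r x v) = (\<lambda>v. \<Sum>x\<in>S. \<psi> (r x) v)"
    if "finite S" "\<And>x. x \<in> S \<Longrightarrow> r x \<in> End_alg act" for S and r :: "'v \<Rightarrow> 'v \<Rightarrow> 'v"
    using that
  proof (induction S)
    case empty
    show ?case using zero_End by (simp add: \<psi>_zero)
  next
    case (insert x S)
    then show ?case using \<psi>D(2)[of "r x" "\<lambda>v. \<Sum>x\<in>S. r x v"] End_alg_add[of "r x" "\<lambda>v. \<Sum>x\<in>S. r x v"]
      by simp
  qed
  \<comment> \<open>The identity is a sum of maps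
    \<open>rank_one x l \<circ> rank_one v0 (f x)\<close>; \<open>\<psi>\<close> reverses each
    factorization, so \<open>s x\<close> acts first and kills \<open>v\<close>.\<close>
  have s_nondegenerate: "v = 0" if "\<And>w. s w v = 0" for v
  proof -
    obtain S f where S: "finite S" "\<And>x. x \<in> S \<Longrightarrow> f x \<in> dual" "\<And>v. (\<Sum>x\<in>S. act x (f x v)) = v"
      using dual_basis[OF fr] by blast
    have E: "rank_one x (f x) \<in> End_alg act" if "x \<in> S" for x
      by (rule rank_one_End_alg[OF S(2)[OF that]])
    have z: "\<psi> (rank_one x (f x)) v = 0" if "x \<in> S" for x
    proof -
      have E0: "rank_one v0 (f x) \<in> End_alg act" by (rule rank_one_End_alg[OF S(2)[OF that]])
      have "rank_one x (f x) = rank_one x l \<circ> rank_one v0 (f x)"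
        by (simp add: rank_one_comp[OF l(1)] l(2) act_one)
      then have "\<psi> (rank_one x (f x)) = \<psi> (rank_one v0 (f x)) \<circ> s x"
        unfolding s_def by (simp add: \<psi>D(4)[OF R E0])
      then show ?thesis
        using \<open>s x v = 0\<close> End_algD(3)[OF \<psi>D(6)[OF E0]] by simp
    qed
    have "id = (\<lambda>v. \<Sum>x\<in>S. rank_one x (f x) v)"
      by (rule ext) (simp add: rank_one_def S(3))
    then have "\<psi> id = (\<lambda>v. \<Sum>x\<in>S. \<psi> (rank_one x (f x)) v)"
      using conjunct2[OF \<psi>_sum[of S "\<lambda>x. rank_one x (f x)"]] S(1) E by simp
    then have "id v = (\<Sum>x\<in>S. \<psi> (rank_one x (f x)) v)" unfolding \<psi>_id by (rule fun_cong)
    then show ?thesis using z by simp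
  qed
  \<comment> \<open>The degree of the form collects \<open>- a0\<close> from \<open>l\<close> and
    \<open>- a1\<close> from \<open>m\<close>.\<close>
  have "adjoint_pair sD Dg sV Vg act \<phi> (inv \<theta>) (\<lambda>v w. inv \<theta> (b v w))"
  proof (rule adjoint_pairI[where ?g0.0 = "- a1 - a0"])
    show "D_antiaut sD Dg (inv \<theta>)" by (rule D.D_antiaut_inv[OF \<theta>])
    show "inv \<theta> (b (r v) w) = inv \<theta> (b v (\<phi> r w))" if "r \<in> End_alg act" for r v w
      by (simp add: b_def s_comp[OF that])
    show "v = 0" if "\<And>w. inv \<theta> (b v w) = 0" for v
      by (rule s_nondegenerate) (simp add: s_b \<theta>i_zero[OF that])
    show "w = 0" if "\<And>v. inv \<theta> (b v w) = 0" for w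
      by (rule s_zero) (intro ext, simp add: s_b[of w] \<theta>i_zero[OF that] s0)
    show "inv \<theta> (b v w) \<in> Dg (- a1 - a0 + a + c)" if "v \<in> Vg a" "w \<in> Vg c" for a c v w
    proof -
      have "inv \<theta> (b v w) \<in> Dg (- a1 + (c + - a0 + a))"
        using \<theta>i(5) b_gr[OF that] by blast
      then show ?thesis by (simp add: algebra_simps)
    qed
  qed (simp_all add: b_add_left b_add_right b_act_left b_act_right \<theta>i(1,2) i\<theta>)
  then show ?thesis by blast
qed

section \<open>Uniqueness up to homogeneous units\<close>

text \<open>A nonzero value on homogeneous vectors is a unit, and multiplying the second argument by
  its inverse normalizes it. Evaluation at such vectors turns relations between forms into relations
  in \<open>D\<close>.\<close>

lemma exists_value_one:
  assumes "adjoint_pair sD Dg sV Vg act \<phi> \<phi>0 B"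
  shows "\<exists>a b. \<exists>v\<in>Vg a. \<exists>w\<in>Vg b. B v w = 1"
proof -
  note B = adjoint_pairD[OF assms]
  obtain b w where w: "w \<in> Vg b" "w \<noteq> 0" using exists_homogeneous by blast
  have "\<exists>a. \<exists>v\<in>Vg a. B v w \<noteq> 0"
  proof (rule ccontr)
    assume *: "\<not> ?thesis"
    have "B v w = 0" for v
      by (induction v rule: V.homogeneous_induct) (use * B(2) in auto)
    then show False using B(9) w(2) by blast
  qed
  then obtain a v where v: "v \<in> Vg a" "B v w \<noteq> 0" by blast
  obtain k where k: "B v w \<in> Dg k" using B(12) v(1) w(1) by meson
  with v have e: "B v w \<in> gr_units Dg" unfolding gr_units_def by blast
  have "B v (act w (ring_inv (B v w))) = 1" using e by (simp add: B(5))
  then show ?thesis using v(1) act_Gr[OF w(1) D.ring_inv_Gr[OF e k]] by blast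
qed

lemma adjoint_pair_unique:
  assumes \<phi>: "End_antiaut sV Vg act \<phi>"
    and P: "adjoint_pair sD Dg sV Vg act \<phi> \<phi>0 B"
    and P': "adjoint_pair sD Dg sV Vg act \<phi> \<phi>0' B'"
  shows "\<exists>d\<in>gr_units Dg. B' = (\<lambda>v w. d * B v w) \<and> \<phi>0' = inner_aut d \<circ> \<phi>0"
proof -
  note B = adjoint_pairD[OF P] and B' = adjoint_pairD[OF P']
  note \<phi>0 = D.D_antiautD[OF B(1)] and \<phi>0' = D.D_antiautD[OF B'(1)]
  obtain a b v0 w0 where v0: "v0 \<in> Vg a" and w0: "w0 \<in> Vg b" and B1: "B v0 w0 = 1"
    using exists_value_one[OF P] by blast
  define c where "c = B' v0 w0"
  \<comment> \<open>This vector is chosen so that both \<open>B x z\<close> and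
    \<open>B' x z\<close> depend on \<open>x\<close> only through \<open>B v0 x\<close>.\<close>
  define z where "z = \<phi> (rank_one v0 (B v0)) w0"
  have R: "rank_one w (B v) \<in> End_alg act" for v w by (rule rank_one_End_alg[OF B(10)])
  have Bz: "B x z = \<phi>0 (B v0 x)" for x
    using B(11)[OF R[of v0 v0], of x w0] by (simp add: z_def rank_one_def B(4) B1)
  have B'z: "B' x z = \<phi>0' (B v0 x) * c" for x
    using B'(11)[OF R[of v0 v0], of x w0] by (simp add: z_def rank_one_def B'(4) c_def)
  have i\<phi>0: "inv \<phi>0 (\<phi>0 x) = x" for x using \<phi>0(4) by (simp add: bij_def)
  have B'_eq: "B' x w = \<phi>0' (inv \<phi>0 (B x w)) * c" for x w
  proof -
    \<comment> \<open>This \<open>s\<close> satisfies \<open>\<phi> s z = w\<close>, so adjunction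
      gives \<open>B x w = B (s x) z\<close>, and likewise for \<open>B'\<close>; the unknown
      \<open>B v0 (s x)\<close> is then eliminated.\<close>
    obtain s where s: "s \<in> End_alg act" "\<phi> s = rank_one w (B w0)"
      using End_antiautD(1)[OF \<phi>] R[of w w0] unfolding bij_betw_def by (metis imageE)
    have "\<phi> s z = w" by (simp add: s(2) rank_one_def Bz B1 \<phi>0(6) act_one)
    then have "B x w = \<phi>0 (B v0 (s x))" "B' x w = \<phi>0' (B v0 (s x)) * c"
      using B(11)[OF s(1), of x z] B'(11)[OF s(1), of x z] by (simp_all add: Bz B'z)
    then show ?thesis by (simp add: i\<phi>0)
  qed
  \<comment> \<open>Every \<open>d\<close> occurs as \<open>B v0 (act w0 d)\<close>; right linearity
    of \<open>B'\<close> there moves \<open>c\<close> to the left.\<close>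
  have "\<phi>0' (inv \<phi>0 d) * c = c * d" for d
    using B'_eq[of v0 "act w0 d"] by (simp add: B(5) B1 B'(5) c_def)
  then have cB: "B' x w = c * B x w" for x w by (simp add: B'_eq)
  have "c \<noteq> 0" using cB B'(8) nontrivial by fastforce
  moreover have "\<exists>k. c \<in> Dg k" using B'(12) v0 w0 unfolding c_def by meson
  ultimately have c: "c \<in> gr_units Dg" unfolding gr_units_def by blast
  \<comment> \<open>Comparing the twists in the first argument at \<open>act v0 d\<close> identifies
    \<open>\<phi>0'\<close>.\<close>
  have "\<phi>0' d * c = c * \<phi>0 d" for d
    using cB[of "act v0 d" w0] by (simp add: B'(4) B(4) B1 c_def[symmetric])
  then have "\<phi>0' = inner_aut c \<circ> \<phi>0"
    by (intro ext) (simp add: inner_aut_eqI[OF D.gr_units_invertible[OF c]])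
  moreover have "B' = (\<lambda>v w. c * B v w)" using cB by blast
  ultimately show ?thesis using c by blast
qed

text \<open>Left multiplication by \<open>d\<close> preserves right linearity and adjunction; moving
  \<open>d\<close> past \<open>\<phi>0 x\<close> in the first argument replaces the latter by
  \<open>inner_aut d (\<phi>0 x)\<close>.\<close>

lemma adjoint_pair_scale:
  assumes P: "adjoint_pair sD Dg sV Vg act \<phi> \<phi>0 B" and d: "d \<in> gr_units Dg"
  shows "adjoint_pair sD Dg sV Vg act \<phi> (inner_aut d \<circ> \<phi>0) (\<lambda>v w. d * B v w)"
proof -
  note B = adjoint_pairD[OF P]
  obtain g0 where g0: "\<And>a b v w. v \<in> Vg a \<Longrightarrow> w \<in> Vg b \<Longrightarrow> B v w \<in> Dg (g0 + a + b)"
    using B(12) by blast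
  obtain h where h: "d \<in> Dg h" using d unfolding gr_units_def by blast
  have cancel: "x = 0" if "d * x = 0" for x
    using that D.ring_inv_cancel(2)[OF d, of x] by simp
  show ?thesis
  proof (rule adjoint_pairI[where ?g0.0 = "h + g0"])
    show "D_antiaut sD Dg (inner_aut d \<circ> \<phi>0)" by (rule D.D_antiaut_inner_aut_comp[OF B(1) d])
    show "d * B v w \<in> Dg (h + g0 + a + b)" if "v \<in> Vg a" "w \<in> Vg b" for a b v w
      using D.Gr_mult[OF h g0[OF that]] by (simp add: add.assoc)
    show "v = 0" if "\<And>w. d * B v w = 0" for v using cancel[OF that] by (rule B(8))
    show "w = 0" if "\<And>v. d * B v w = 0" for w using cancel[OF that] by (rule B(9))
  qed (use d in \<open>simp_all add: B(2-5) B(11) inner_aut_def distrib_left mult.assoc\<close>)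
qed

section \<open>Involutions and hermitian forms\<close>

text \<open>Applying adjunction to \<open>\<phi> r\<close> and using
  \<open>\<phi> (\<phi> r) = r\<close> gives adjunction with the arguments exchanged;
  \<open>inv \<phi>0\<close> turns left factors from \<open>D\<close> into right factors and
  conversely.\<close>

lemma adjoint_pair_swap:
  assumes \<phi>: "End_involution sV Vg act \<phi>" and P: "adjoint_pair sD Dg sV Vg act \<phi> \<phi>0 B"
  shows "adjoint_pair sD Dg sV Vg act \<phi> (inv \<phi>0) (\<lambda>v w. inv \<phi>0 (B w v))"
proof -
  note B = adjoint_pairD[OF P]
  note \<phi>0 = D.D_antiautD[OF B(1)] and i\<phi>0 = D.D_antiautD[OF D.D_antiaut_inv[OF B(1)]]
  have inv: "inv \<phi>0 (\<phi>0 x) = x" for x using \<phi>0(4) by (simp add: bij_def)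
  have cancel: "x = 0" if "inv \<phi>0 x = 0" for x
    using that \<phi>0(4,7) by (metis bij_inv_eq_iff)
  obtain g0 where g0: "\<And>a b v w. v \<in> Vg a \<Longrightarrow> w \<in> Vg b \<Longrightarrow> B v w \<in> Dg (g0 + a + b)"
    using B(12) by blast
  show ?thesis
  proof (rule adjoint_pairI[where ?g0.0 = g0])
    show "D_antiaut sD Dg (inv \<phi>0)" by (rule D.D_antiaut_inv[OF B(1)])
    show "inv \<phi>0 (B w v) \<in> Dg (g0 + a + b)" if "v \<in> Vg a" "w \<in> Vg b" for a b v w
    proof -
      have "inv \<phi>0 (B w v) \<in> Dg (g0 + b + a)" using i\<phi>0(5) g0[OF that(2,1)] by blast
      then show ?thesis by (simp add: ac_simps)
    qed
    show "v = 0" if "\<And>w. inv \<phi>0 (B w v) = 0" for v using cancel[OF that] by (rule B(9))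
    show "w = 0" if "\<And>v. inv \<phi>0 (B w v) = 0" for w using cancel[OF that] by (rule B(8))
    show "inv \<phi>0 (B w (r v)) = inv \<phi>0 (B (\<phi> r w) v)" if r: "r \<in> End_alg act" for r v w
    proof -
      have "\<phi> r \<in> End_alg act" "\<phi> (\<phi> r) = r"
        using \<phi> r End_antiautD(6) unfolding End_involution_def by blast+
      then show ?thesis using B(11)[of "\<phi> r" w v] by simp
    qed
  qed (simp_all add: B(2-5) i\<phi>0(1,2) inv)
qed

text \<open>Every \<open>x\<close> is a value of \<open>B\<close> because \<open>1\<close> is one.
  Applying the sign relation twice at such a value gives \<open>\<phi>0 (\<phi>0 x) = x\<close>,
  since \<open>\<delta> * \<delta> = 1\<close>.\<close>

lemma hermitian_pairI:
  assumes P: "adjoint_pair sD Dg sV Vg act \<phi> \<phi>0 B"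
    and \<delta>: "\<delta> \<in> {1, -1}" and H: "hermitian_sign sD \<delta> \<phi>0 B"
  shows "hermitian_pair sD Dg sV Vg act \<phi> \<delta> \<phi>0 B"
proof -
  note B = adjoint_pairD[OF P]
  note \<phi>0 = D.D_antiautD[OF B(1)]
  have H': "B w v = sD \<delta> (\<phi>0 (B v w))" for v w using H unfolding hermitian_sign_def by blast
  obtain v w where vw: "B v w = 1" using exists_value_one[OF P] by blast
  have "\<phi>0 (\<phi>0 x) = x" for x
  proof -
    have "x = B v (act w x)" by (simp add: B(5) vw)
    also have "\<dots> = sD \<delta> (\<phi>0 (B (act w x) v))" by (rule H')
    also have "\<dots> = sD \<delta> (\<phi>0 (sD \<delta> (\<phi>0 (B v (act w x)))))"
      by (simp only: H'[of "act w x" v])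
    also have "\<dots> = sD (\<delta> * \<delta>) (\<phi>0 (\<phi>0 x))" by (simp add: B(5) vw \<phi>0(3))
    also have "\<dots> = \<phi>0 (\<phi>0 x)" using \<delta> by auto
    finally show ?thesis by simp
  qed
  then show ?thesis
    using assms B(1) unfolding hermitian_pair_def D_involution_def by blast
qed

lemma exists_hermitian_pair:
  assumes fr: "finite_rank act" and \<phi>: "End_involution sV Vg act \<phi>"
  shows "\<exists>\<phi>0 B \<delta>. hermitian_pair sD Dg sV Vg act \<phi> \<delta> \<phi>0 B"
proof -
  have \<phi>': "End_antiaut sV Vg act \<phi>" using \<phi> unfolding End_involution_def by blast
  obtain \<phi>0 B where P: "adjoint_pair sD Dg sV Vg act \<phi> \<phi>0 B"
    using exists_adjoint_pair[OF fr \<phi>'] by blast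
  note B = adjoint_pairD[OF P]
  note \<phi>0 = D.D_antiautD[OF B(1)] and i\<phi>0 = D.D_antiautD[OF D.D_antiaut_inv[OF B(1)]]
  obtain d where d: "d \<in> gr_units Dg" and dB: "\<And>v w. inv \<phi>0 (B w v) = d * B v w"
    using adjoint_pair_unique[OF \<phi>' P adjoint_pair_swap[OF \<phi> P]] by metis
  have B_swap: "B w v = \<phi>0 (d * B v w)" for v w
    using dB \<phi>0(4) by (metis bij_inv_eq_iff)
  obtain a b v w where v: "v \<in> Vg a" and w: "w \<in> Vg b" and vw: "B v w = 1"
    using exists_value_one[OF P] by blast
  \<comment> \<open>The arguments are exchanged twice at a value \<open>1\<close> of
    \<open>B\<close>.\<close>
  have "\<phi>0 (d * \<phi>0 d) = \<phi>0 1"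
    using B_swap[of v w] B_swap[of w v] by (simp add: vw \<phi>0(6))
  then have "d * \<phi>0 d = 1" using \<phi>0(4) by (simp add: bij_def inj_eq)
  then have "\<phi>0 d = ring_inv d" using D.ring_inv_cancel(2)[OF d, of "\<phi>0 d"] by simp
  then have \<phi>0B: "\<phi>0 (B v w) = B w v * d" for v w
    using d by (simp add: B_swap[of w v] \<phi>0(2) mult.assoc)
  \<comment> \<open>The value \<open>B v w = 1\<close> has degree \<open>0\<close>, and
    \<open>d = inv \<phi>0 (B w v)\<close> has the same degree. This makes \<open>1 + d\<close>
    homogeneous, hence a unit when nonzero.\<close>
  have d0: "d \<in> Dg 0"
  proof -
    obtain g0 where g0: "\<And>a b v w. v \<in> Vg a \<Longrightarrow> w \<in> Vg b \<Longrightarrow> B v w \<in> Dg (g0 + a + b)"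
      using B(12) by blast
    have "g0 + a + b = 0"
      using D.proj_homogeneous[OF D.one_Gr, of "g0 + a + b"]
        D.proj_homogeneous[OF g0[OF v w], of "g0 + a + b"] by (simp add: vw split: if_splits)
    moreover have "inv \<phi>0 (B w v) \<in> Dg (g0 + b + a)" using i\<phi>0(5) g0[OF w v] by blast
    ultimately show ?thesis by (simp add: dB vw ac_simps)
  qed
  show ?thesis
  proof (cases "1 + d = 0")
    case True
    then have "d = - 1" by (simp add: eq_neg_iff_add_eq_0 add.commute)
    have "B w v = - \<phi>0 (B v w)" for v w
      using B_swap[of w v] by (simp only: \<open>d = - 1\<close> \<phi>0(8) mult_minus_left mult_1)
    then have "hermitian_sign sD (- 1) \<phi>0 B" unfolding hermitian_sign_def by (metis D.scale_minus_left D.scale_one)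
    then show ?thesis using hermitian_pairI[OF P] by blast
  next
    case False
    let ?e = "1 + d"
    have e: "?e \<in> gr_units Dg"
      using False D.add_Gr[OF D.one_Gr d0] unfolding gr_units_def by blast
    have "?e * B w v = inner_aut ?e (\<phi>0 (?e * B v w))" for v w
    proof (rule inner_aut_eqI[OF D.gr_units_invertible[OF e]])
      \<comment> \<open>Here \<open>\<phi>0 (B v w)\<close> contributes \<open>B w v * d\<close>,
        and \<open>\<phi>0 (d * B v w)\<close> contributes \<open>B w v\<close>.\<close>
      have "\<phi>0 (?e * B v w) = B w v * ?e"
        by (simp add: distrib_left distrib_right \<phi>0(1) \<phi>0B B_swap[symmetric])
      then show "?e * B w v * ?e = ?e * \<phi>0 (?e * B v w)" by (simp only: mult.assoc)
    qed
    then have "hermitian_sign sD 1 (inner_aut ?e \<circ> \<phi>0) (\<lambda>v w. ?e * B v w)"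
      unfolding hermitian_sign_def comp_apply D.scale_one by blast
    then show ?thesis using hermitian_pairI[OF adjoint_pair_scale[OF P e]] by blast
  qed
qed

section \<open>Comparison of hermitian pairs\<close>

text \<open>\<open>\<phi>0\<close> turns \<open>d * B v w\<close> into
  \<open>\<phi>0 (B v w) * \<phi>0 d\<close>. When \<open>\<phi>0 d\<close> is \<open>d\<close> up
  to sign, conjugation by \<open>d\<close> moves that factor to the left, and the sign multiplies
  \<open>\<delta>\<close>.\<close>

lemma hermitian_sign_scale:
  assumes \<phi>0: "D_antiaut sD Dg \<phi>0" and d: "d \<in> gr_units Dg"
    and H: "hermitian_sign sD \<delta> \<phi>0 B"
  shows "\<phi>0 d = d \<Longrightarrow> hermitian_sign sD \<delta> (inner_aut d \<circ> \<phi>0) (\<lambda>v w. d * B v w)"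
    and "\<phi>0 d = - d \<Longrightarrow> hermitian_sign sD (- \<delta>) (inner_aut d \<circ> \<phi>0) (\<lambda>v w. d * B v w)"
proof -
  have H': "B w v = sD \<delta> (\<phi>0 (B v w))" for v w using H unfolding hermitian_sign_def by blast
  have dB: "sD \<delta> (inner_aut d (\<phi>0 (B v w) * d)) = d * B w v" for v w
  proof -
    have "inner_aut d (\<phi>0 (B v w) * d) = d * \<phi>0 (B v w)"
      using d by (simp add: inner_aut_def mult.assoc)
    then show ?thesis by (simp only: D.scale_mult_right[symmetric] H'[of w v])
  qed
  note \<phi>0_mult = D.D_antiautD(2)[OF \<phi>0]
  show "hermitian_sign sD \<delta> (inner_aut d \<circ> \<phi>0) (\<lambda>v w. d * B v w)" if "\<phi>0 d = d"
    unfolding hermitian_sign_def by (simp add: \<phi>0_mult that dB)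
  show "hermitian_sign sD (- \<delta>) (inner_aut d \<circ> \<phi>0) (\<lambda>v w. d * B v w)" if "\<phi>0 d = - d"
  proof -
    have "inner_aut d (- x) = - inner_aut d x" for x by (simp add: inner_aut_def)
    then show ?thesis unfolding hermitian_sign_def by (simp add: \<phi>0_mult that dB)
  qed
qed

text \<open>Evaluating both sign relations where \<open>B v w = 1\<close> and cancelling
  \<open>d\<close> gives \<open>sD \<delta> d = sD \<epsilon> (\<phi>0 d)\<close>, which determines
  \<open>\<phi>0 d\<close> up to sign.\<close>

lemma hermitian_pair_unique:
  assumes \<phi>: "End_antiaut sV Vg act \<phi>"
    and P: "hermitian_pair sD Dg sV Vg act \<phi> \<delta> \<phi>0 B"
    and P': "hermitian_pair sD Dg sV Vg act \<phi> \<epsilon> \<phi>0' B'"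
  shows "\<exists>d\<in>gr_units Dg. \<phi>0' = inner_aut d \<circ> \<phi>0 \<and> B' = (\<lambda>v w. d * B v w) \<and>
    (\<phi>0 d = d \<or> \<phi>0 d = - d)"
proof -
  have A: "adjoint_pair sD Dg sV Vg act \<phi> \<phi>0 B" "adjoint_pair sD Dg sV Vg act \<phi> \<phi>0' B'"
    and signs: "\<delta> \<in> {1, -1}" "\<epsilon> \<in> {1, -1}"
    and H: "B w v = sD \<delta> (\<phi>0 (B v w))" "B' w v = sD \<epsilon> (\<phi>0' (B' v w))" for v w
    using P P' unfolding hermitian_pair_def hermitian_sign_def by blast+
  obtain d where d: "d \<in> gr_units Dg" and eq: "B' = (\<lambda>v w. d * B v w)" "\<phi>0' = inner_aut d \<circ> \<phi>0"
    using adjoint_pair_unique[OF \<phi> A] by blast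
  obtain v w where vw: "B v w = 1" using exists_value_one[OF A(1)] by blast
  have "d * sD \<delta> 1 = sD \<epsilon> (inner_aut d (\<phi>0 d))"
    using H(2)[of w v] H(1)[of w v] D.D_antiautD(6)[OF adjoint_pairD(1)[OF A(1)]]
    by (simp add: eq vw)
  then have "d * sD \<delta> 1 * d = sD \<epsilon> (inner_aut d (\<phi>0 d) * d)"
    by (simp add: D.scale_mult_left)
  then have "d * sD \<delta> d = d * sD \<epsilon> (\<phi>0 d)"
    by (simp add: inner_aut_mult[OF D.gr_units_invertible[OF d]] D.scale_mult_left D.scale_mult_right)
  then have "sD \<delta> d = sD \<epsilon> (\<phi>0 d)" using D.ring_inv_cancel(2)[OF d] by metis
  then have "\<phi>0 d = d \<or> \<phi>0 d = - d"
    using signs equation_minus_iff[of d "\<phi>0 d"] by auto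
  with d eq show ?thesis by blast
qed

text \<open>If \<open>d + \<phi>0 d\<close> is nonzero, it is symmetric and induces the same inner automorphism as \<open>d\<close>.\<close>

lemma inner_aut_symmetric:
  assumes inv: "D_involution sD Dg \<phi>0" "D_involution sD Dg \<phi>0'"
    and inner: "is_inner_aut (\<phi>0' \<circ> inv \<phi>0)"
  shows "\<exists>d\<in>gr_units Dg. \<phi>0' = inner_aut d \<circ> \<phi>0 \<and> (\<phi>0 d = d \<or> \<phi>0 d = - d)"
proof -
  have A: "D_antiaut sD Dg \<phi>0" "D_antiaut sD Dg \<phi>0'"
    and inv2: "\<phi>0 (\<phi>0 x) = x" "\<phi>0' (\<phi>0' x) = x" for x
    using inv unfolding D_involution_def by blast+
  note \<phi>0 = D.D_antiautD[OF A(1)]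
  obtain u where u: "invertible_elt u" "\<phi>0' \<circ> inv \<phi>0 = inner_aut u"
    using inner unfolding is_inner_aut_def by blast
  \<comment> \<open>\<open>u\<close> is only known to be invertible. Its conjugation is a composite
    of degree-preserving maps, so a homogeneous \<open>d\<close> can replace
    \<open>u\<close>.\<close>
  have "inner_aut u x \<in> Dg g" if "x \<in> Dg g" for x g
    using that D.D_antiautD(5)[OF D.D_antiaut_inv[OF A(1)]] D.D_antiautD(5)[OF A(2)]
    unfolding u(2)[symmetric] by (metis comp_apply imageI)
  then obtain d where d: "d \<in> gr_units Dg" and ud: "inner_aut u = inner_aut d"
    using D.inner_aut_homogeneous[OF u(1)] by blast
  have "\<phi>0' x = inner_aut d (\<phi>0 x)" for x
    using fun_cong[OF u(2), of "\<phi>0 x"] \<phi>0(4) by (simp add: ud bij_def)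
  then have eq: "\<phi>0' = inner_aut d \<circ> \<phi>0" by auto
  note mult_d = inner_aut_mult[OF D.gr_units_invertible[OF d]]
  \<comment> \<open>Since \<open>inner_aut d \<circ> \<phi>0\<close> squares to the identity,
    \<open>\<phi>0 d\<close> satisfies the same commutation rule with \<open>inner_aut d\<close> as
    \<open>d\<close> does.\<close>
  have \<phi>0d: "inner_aut d x * \<phi>0 d = \<phi>0 d * x" for x
  proof -
    let ?z = "inner_aut d x"
    have z: "inner_aut d (\<phi>0 ?z) = \<phi>0 x"
      using inv2(2)[of "\<phi>0 x"] by (simp add: eq inv2(1))
    have "\<phi>0 d * x = \<phi>0 (\<phi>0 x * d)" by (simp add: \<phi>0(2) inv2(1))
    also have "\<dots> = \<phi>0 (d * \<phi>0 ?z)" by (simp only: z[symmetric] mult_d)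
    also have "\<dots> = ?z * \<phi>0 d" by (simp add: \<phi>0(2) inv2(1))
    finally show ?thesis ..
  qed
  show ?thesis
  proof (cases "d + \<phi>0 d = 0")
    case True
    then have "\<phi>0 d = - d" by (simp add: eq_neg_iff_add_eq_0 add.commute)
    with d eq show ?thesis by blast
  next
    case False
    let ?e = "d + \<phi>0 d"
    obtain h where h: "d \<in> Dg h" using d unfolding gr_units_def by blast
    then have "?e \<in> Dg h" using \<phi>0(5) D.add_Gr by blast
    with False have e: "?e \<in> gr_units Dg" unfolding gr_units_def by blast
    have "inner_aut d x = inner_aut ?e x" for x
      by (rule inner_aut_eqI[OF D.gr_units_invertible[OF e]])
        (simp add: distrib_left distrib_right mult_d \<phi>0d)
    then have "\<phi>0' = inner_aut ?e \<circ> \<phi>0" unfolding eq by auto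
    moreover have "\<phi>0 ?e = ?e" by (simp add: \<phi>0(1) inv2(1) add.commute)
    ultimately show ?thesis using e by blast
  qed
qed

end

section \<open>Combination of existence, uniqueness and hermitian normalization\<close>

theorem theorem3p1:
  fixes sD :: "'f::field \<Rightarrow> 'd::ring_1 \<Rightarrow> 'd" and Dg :: "'g::ab_group_add \<Rightarrow> 'd set"
    and sV :: "'f \<Rightarrow> 'v::ab_group_add \<Rightarrow> 'v" and Vg :: "'g \<Rightarrow> 'v set"
    and act :: "'v \<Rightarrow> 'd \<Rightarrow> 'v" and \<phi> :: "('v \<Rightarrow> 'v) \<Rightarrow> ('v \<Rightarrow> 'v)"
  assumes "graded_division_algebra sD Dg"
    and "graded_right_module sD Dg sV Vg act"
    and "\<exists>v::'v. v \<noteq> 0"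
    and "finite_rank act"
  shows
    "(End_antiaut sV Vg act \<phi> \<longrightarrow>
        (\<exists>\<phi>0 B. adjoint_pair sD Dg sV Vg act \<phi> \<phi>0 B)) \<and>
     (End_antiaut sV Vg act \<phi> \<longrightarrow>
        (\<forall>\<phi>0 B \<phi>0' B'. adjoint_pair sD Dg sV Vg act \<phi> \<phi>0 B \<longrightarrow>
           (adjoint_pair sD Dg sV Vg act \<phi> \<phi>0' B' \<longleftrightarrow>
            (\<exists>d\<in>gr_units Dg. B' = (\<lambda>v w. d * B v w) \<and> \<phi>0' = inner_aut d \<circ> \<phi>0)))) \<and>
     (End_involution sV Vg act \<phi> \<longrightarrow>
        (\<exists>\<phi>0 B \<delta>. hermitian_pair sD Dg sV Vg act \<phi> \<delta> \<phi>0 B)) \<and>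
     (End_involution sV Vg act \<phi> \<longrightarrow>
        (\<forall>\<phi>0 B \<delta>. hermitian_pair sD Dg sV Vg act \<phi> \<delta> \<phi>0 B \<longrightarrow>
           (\<forall>\<phi>0' B'. (\<exists>\<epsilon>. hermitian_pair sD Dg sV Vg act \<phi> \<epsilon> \<phi>0' B') \<longrightarrow>
              (\<exists>d\<in>gr_units Dg. \<phi>0' = inner_aut d \<circ> \<phi>0 \<and> B' = (\<lambda>v w. d * B v w) \<and>
                 (\<phi>0 d = d \<or> \<phi>0 d = - d) \<and>
                 (\<phi>0 d = d \<longrightarrow> hermitian_sign sD \<delta> \<phi>0' B') \<and>
                 (\<phi>0 d = - d \<longrightarrow> hermitian_sign sD (- \<delta>) \<phi>0' B'))) \<and>
           (\<forall>\<phi>0'. D_involution sD Dg \<phi>0' \<and> is_inner_aut (\<phi>0' \<circ> inv \<phi>0) \<longrightarrow>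
              (\<exists>d\<in>gr_units Dg. \<phi>0' = inner_aut d \<circ> \<phi>0 \<and>
                 (\<exists>\<epsilon>. hermitian_pair sD Dg sV Vg act \<phi> \<epsilon> \<phi>0' (\<lambda>v w. d * B v w))))))"
proof -
  interpret graded_division_module sD Dg sV Vg act
    by (intro graded_division_module.intro graded_division_module_axioms.intro assms(1-3))
  have p2: "adjoint_pair sD Dg sV Vg act \<phi> \<phi>0' B' \<longleftrightarrow>
      (\<exists>d\<in>gr_units Dg. B' = (\<lambda>v w. d * B v w) \<and> \<phi>0' = inner_aut d \<circ> \<phi>0)"
    if "End_antiaut sV Vg act \<phi>" "adjoint_pair sD Dg sV Vg act \<phi> \<phi>0 B" for \<phi>0 B \<phi>0' B'
    using adjoint_pair_unique[OF that] adjoint_pair_scale[OF that(2)] by blast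
  have anti: "End_antiaut sV Vg act \<phi>" if "End_involution sV Vg act \<phi>"
    using that unfolding End_involution_def by blast
  have p4i: "\<exists>d\<in>gr_units Dg. \<phi>0' = inner_aut d \<circ> \<phi>0 \<and> B' = (\<lambda>v w. d * B v w) \<and>
      (\<phi>0 d = d \<or> \<phi>0 d = - d) \<and>
      (\<phi>0 d = d \<longrightarrow> hermitian_sign sD \<delta> \<phi>0' B') \<and>
      (\<phi>0 d = - d \<longrightarrow> hermitian_sign sD (- \<delta>) \<phi>0' B')"
    if \<phi>: "End_involution sV Vg act \<phi>" and P: "hermitian_pair sD Dg sV Vg act \<phi> \<delta> \<phi>0 B"
      and P': "hermitian_pair sD Dg sV Vg act \<phi> \<epsilon> \<phi>0' B'" for \<phi>0 B \<delta> \<phi>0' B' \<epsilon>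
  proof -
    obtain d where d: "d \<in> gr_units Dg" "\<phi>0' = inner_aut d \<circ> \<phi>0" "B' = (\<lambda>v w. d * B v w)"
        "\<phi>0 d = d \<or> \<phi>0 d = - d"
      using hermitian_pair_unique[OF anti[OF \<phi>] P P'] by blast
    have "D_antiaut sD Dg \<phi>0" "hermitian_sign sD \<delta> \<phi>0 B"
      using P unfolding hermitian_pair_def D_involution_def by blast+
    \<comment> \<open>Both sign implications come from scaling; in characteristic 2 their premises
      coincide.\<close>
    then show ?thesis using d hermitian_sign_scale by blast
  qed
  have p4ii: "\<exists>d\<in>gr_units Dg. \<phi>0' = inner_aut d \<circ> \<phi>0 \<and>
      (\<exists>\<epsilon>. hermitian_pair sD Dg sV Vg act \<phi> \<epsilon> \<phi>0' (\<lambda>v w. d * B v w))"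
    if P: "hermitian_pair sD Dg sV Vg act \<phi> \<delta> \<phi>0 B"
      and inv: "D_involution sD Dg \<phi>0'" "is_inner_aut (\<phi>0' \<circ> inv \<phi>0)" for \<phi>0 B \<delta> \<phi>0'
  proof -
    have A: "adjoint_pair sD Dg sV Vg act \<phi> \<phi>0 B" "D_involution sD Dg \<phi>0" "D_antiaut sD Dg \<phi>0"
      and \<delta>: "\<delta> \<in> {1, -1}" "- \<delta> \<in> {1, -1}" and H: "hermitian_sign sD \<delta> \<phi>0 B"
      using P unfolding hermitian_pair_def D_involution_def by auto
    obtain d where d: "d \<in> gr_units Dg" "\<phi>0' = inner_aut d \<circ> \<phi>0" "\<phi>0 d = d \<or> \<phi>0 d = - d"
      using inner_aut_symmetric[OF A(2) inv] by blast
    \<comment> \<open>The sign of the new form is \<open>\<delta>\<close> or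
      \<open>- \<delta>\<close> according to the symmetry of \<open>d\<close>.\<close>
    show ?thesis
      using d hermitian_pairI[OF adjoint_pair_scale[OF A(1) d(1)]] \<delta>
        hermitian_sign_scale[OF A(3) d(1) H] by metis
  qed
  show ?thesis
    by (intro conjI impI allI; (elim conjE exE)?)
      (rule exists_adjoint_pair[OF assms(4)] p2 exists_hermitian_pair[OF assms(4)] p4i p4ii;
        assumption)+
qed

end
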